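(* Let $k\in\mathbb{N}$ and $\varepsilon>0$, and let $C=C(k,\varepsilon)$ be a sufficiently large constant. Let $n$ be divisible by $k$. Then for all $p\geq \frac{C\log n}{n}$, with high probability the random hypergraph $H^k_{n,p}$ has the following property: every spanning subhypergraph $H\subseteq H^k_{n,p}$ with $\delta_{k-1}(H)\geq (1/2+\varepsilon)np$ contains a perfect matching.
   Context: $H^k_{n,p}$ is the random $k$-uniform hypergraph on vertex set $[n]$ in which each $k$-subset of $[n]$ is an edge independently with probability $p$. "With high probability" means with probability tending to $1$ as $n\to\infty$. For a $k$-uniform hypergraph $H$ and a vertex set $X$, $d(X)$ is the number of edges of $H$ containing $X$, and $\delta_{k-1}(H)=\min\{d(X): X\subseteq V(H),|X|=k-1\}$. A perfect matching is a set of pairwise vertex-disjoint edges covering every vertex.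
   Formalization: The formal theorem assumes k ≥ 2 instead of arbitrary k in N: for k = 1 the claim fails (p = 1/2, ε = 1/4: the random hypergraph itself has about n/2 ≥ (3/4)n/2 edges but not all n singletons), and for k = 0 the degree δ_{k-1} is undefined. *)

theory Defs
  imports "HOL-Probability.Probability"
begin

record 'a hypergraph =
  verts :: "'a set"
  edges :: "'a set set"

definition degree :: "'a hypergraph \<Rightarrow> 'a set \<Rightarrow> nat" where
  "degree H X = card {e \<in> edges H. X \<subseteq> e}"

definition min_degree :: "nat \<Rightarrow> 'a hypergraph \<Rightarrow> nat" where
  "min_degree j H = Min (degree H ` {X. X \<subseteq> verts H \<and> card X = j})"

definition spanning_subhypergraph :: "'a hypergraph \<Rightarrow> 'a hypergraph \<Rightarrow> bool" where
  "spanning_subhypergraph H G \<longleftrightarrow> verts H = verts G \<and> edges H \<subseteq> edges G"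

definition perfect_matching :: "'a hypergraph \<Rightarrow> 'a set set \<Rightarrow> bool" where
  "perfect_matching H M \<longleftrightarrow> M \<subseteq> edges H \<and> disjoint M \<and> \<Union>M = verts H"

definition k_subsets :: "nat \<Rightarrow> nat \<Rightarrow> nat set set" where
  "k_subsets k n = {e. e \<subseteq> {1..n} \<and> card e = k}"

definition random_hypergraph :: "nat \<Rightarrow> nat \<Rightarrow> real \<Rightarrow> nat hypergraph pmf" where
  "random_hypergraph k n p =
     map_pmf (\<lambda>f. \<lparr>verts = {1..n}, edges = {e \<in> k_subsets k n. f e}\<rparr>)
       (Pi_pmf (k_subsets k n) False (\<lambda>_. bernoulli_pmf p))"

end

theory Submission
  imports Defs
begin

text \<open>
  Write \<open>n = k m\<close> and \<open>h = (1/2 + \<epsilon>/2) m p\<close>. Let \<open>H\<close> have codegrees at least \<open>(1/2 + \<epsilon>) n p\<close>, and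
  expose a uniformly random ordering of the vertices. Its first \<open>(k - 1) m\<close> vertices are cut into
  \<open>m\<close> consecutive blocks of size \<open>k - 1\<close>, and the last \<open>m\<close> vertices form a set \<open>W\<close>. Throughout
  the exposure at least \<open>n / k\<close> vertices remain, so the neighbourhoods of all \<open>(k - 1)\<close>-sets in the
  remaining vertices stay proportional to their size; consequently every block has at
  least \<open>h\<close> neighbours in \<open>W\<close>, and every vertex of \<open>W\<close> extends at least \<open>h\<close> blocks to edges. This needs
  no randomness of the host hypergraph, only \<open>n p \<ge> C ln n\<close>.

  The random hypergraph has, with high probability, fewer than \<open>h x\<close> edges between
  any \<open>x\<close> sets of size \<open>k - 1\<close> and any \<open>x \<le> (m + 1) / 2\<close> further vertices: there are at most
  \<open>n ^ (k x)\<close> choices, each failing with probability \<open>n ^ (- \<Omega>(C x))\<close>. Hall's condition between the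
  blocks and \<open>W\<close> follows, applied to the blocks for small sets and to \<open>W\<close> for large ones.
\<close>

section \<open>Matchings in bipartite graphs\<close>

text \<open>Induction on \<open>card I\<close>. If a nonempty proper subset \<open>J\<close> is
  tight, match \<open>J\<close> inside its neighbourhood and the other indices outside it. If none
  is tight, match any index to any of its neighbours and remove both.\<close>

theorem hall_marriage:
  fixes N :: "'a \<Rightarrow> 'b set"
  assumes "finite I" "\<And>i. i \<in> I \<Longrightarrow> finite (N i)"
    and "\<And>J. J \<subseteq> I \<Longrightarrow> card J \<le> card (\<Union>(N ` J))"
  shows "\<exists>f. inj_on f I \<and> (\<forall>i\<in>I. f i \<in> N i)"
  using assms
proof (induction "card I" arbitrary: I N rule: less_induct)
  case less
  note fin = less.prems(1) and finN = less.prems(2) and hall = less.prems(3)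
  show ?case
  proof (cases "I = {}")
    case True then show ?thesis by auto
  next
    case False
    show ?thesis
    proof (cases "\<exists>J. J \<noteq> {} \<and> J \<subset> I \<and> card J = card (\<Union>(N ` J))")
      case True
      then obtain J where J: "J \<noteq> {}" "J \<subset> I" "card J = card (\<Union>(N ` J))" by blast
      let ?U = "\<Union>(N ` J)"
      have finJ: "finite J" using J fin finite_subset by blast
      have finU: "finite ?U" using J finJ finN by blast
      have "\<exists>f. inj_on f J \<and> (\<forall>i\<in>J. f i \<in> N i)"
      proof (rule less.hyps)
        show "card J < card I" using J fin by (intro psubset_card_mono)
        show "card K \<le> card (\<Union>(N ` K))" if "K \<subseteq> J" for K
          using that J by (intro hall) auto
      qed (use finJ finN J in auto)
      then obtain f where f: "inj_on f J" "\<forall>i\<in>J. f i \<in> N i" by blast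
      have "I - J \<subset> I" using J by blast
      then have "card (I - J) < card I" using fin by (intro psubset_card_mono)
      moreover have "card K \<le> card (\<Union>((\<lambda>i. N i - ?U) ` K))" if K: "K \<subseteq> I - J" for K
      proof -
        have finK: "finite K" using K fin finite_subset by blast
        have finNK: "finite (\<Union>(N ` K))" using K finK finN by blast
        have "card K + card J = card (K \<union> J)"
          using K finK finJ by (subst card_Un_disjoint) auto
        also have "\<dots> \<le> card (\<Union>(N ` (K \<union> J)))" using K J by (intro hall) auto
        also have "\<Union>(N ` (K \<union> J)) = (\<Union>((\<lambda>i. N i - ?U) ` K)) \<union> ?U" by auto
        also have "card \<dots> \<le> card (\<Union>((\<lambda>i. N i - ?U) ` K)) + card ?U" by (rule card_Un_le)
        finally show ?thesis using J by simp
      qed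
      ultimately have "\<exists>g. inj_on g (I - J) \<and> (\<forall>i\<in>I - J. g i \<in> N i - ?U)"
        using fin finN by (intro less.hyps) auto
      then obtain g where g: "inj_on g (I - J)" "\<forall>i\<in>I - J. g i \<in> N i - ?U" by blast
      define h where "h i = (if i \<in> J then f i else g i)" for i
      have fU: "f a \<in> ?U" if "a \<in> J" for a using bspec[OF f(2) that] that by (rule UN_I[rotated])
      have gU: "g b \<notin> ?U" if "b \<in> I - J" for b using bspec[OF g(2) that] by simp
      have "inj_on h I"
      proof (rule inj_onI)
        fix i j assume ij: "i \<in> I" "j \<in> I" "h i = h j"
        consider "i \<in> J" "j \<in> J" | "i \<in> I - J" "j \<in> I - J" | "i \<in> J" "j \<in> I - J" | "i \<in> I - J" "j \<in> J"
          using ij(1,2) by fast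
        then show "i = j"
        proof cases
          case 1 then show ?thesis using ij(3) inj_onD[OF f(1)] by (simp add: h_def)
        next
          case 2 then show ?thesis using ij(3) inj_onD[OF g(1)] by (simp add: h_def)
        next
          case 3 then show ?thesis using ij(3) fU[of i] gU[of j] by (simp add: h_def)
        next
          case 4 then show ?thesis using ij(3) fU[of j] gU[of i] by (simp add: h_def)
        qed
      qed
      moreover have "\<forall>i\<in>I. h i \<in> N i" using f(2) g(2) by (simp add: h_def)
      ultimately show ?thesis by blast
    next
      case nocrit: False
      obtain i where i: "i \<in> I" using False by blast
      have "card {i} \<le> card (\<Union>(N ` {i}))" using i by (intro hall) auto
      then obtain y where y: "y \<in> N i" by fastforce
      have "card (I - {i}) < card I" using i fin by (meson card_Diff1_less)
      moreover have "card K \<le> card (\<Union>((\<lambda>i. N i - {y}) ` K))" if K: "K \<subseteq> I - {i}" for K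
      proof (cases "K = {}")
        case False
        have finK: "finite K" using K fin finite_subset by blast
        have "K \<subset> I" using K i by blast
        \<comment> \<open>No nonempty proper subset is tight, so the inequality is strict and
          absorbs the loss of \<open>y\<close>.\<close>
        then have "card K < card (\<Union>(N ` K))"
          using nocrit hall[of K] False by (metis order.strict_iff_order psubsetE)
        moreover have "(\<Union>((\<lambda>i. N i - {y}) ` K)) = \<Union>(N ` K) - {y}" by auto
        moreover have "card (\<Union>(N ` K)) \<le> card (\<Union>(N ` K) - {y}) + 1"
          by (simp add: card_Diff_singleton_if Suc_diff_le) (metis Suc_pred le_SucI order_refl gr0I zero_le)
        ultimately show ?thesis by simp
      qed simp
      ultimately have "\<exists>g. inj_on g (I - {i}) \<and> (\<forall>j\<in>I - {i}. g j \<in> N j - {y})"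
        using fin finN by (intro less.hyps) auto
      then obtain g where g: "inj_on g (I - {i})" "\<forall>j\<in>I - {i}. g j \<in> N j - {y}" by blast
      have "inj_on (g(i := y)) I"
        using g i by (auto simp: inj_on_def)
      moreover have "\<forall>j\<in>I. (g(i := y)) j \<in> N j" using g y by auto
      ultimately show ?thesis by blast
    qed
  qed
qed

text \<open>A set \<open>J\<close> violating Hall's condition has all its relations in a smaller set
  \<open>?U\<close>, and \<open>W - ?U\<close> has all of its own in \<open>I - J\<close>. Depending
  on the size of \<open>J\<close>, one of these two pairs is small enough for \<open>sparse\<close>
  and has too many relations.\<close>

lemma bipartite_matching_of_sparse_pairs:
  fixes R :: "'a \<Rightarrow> 'b \<Rightarrow> bool" and h :: real
  assumes fin: "finite I" "finite W" and card_eq: "card I = m" "card W = m"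
    and degI: "\<And>i. i \<in> I \<Longrightarrow> h \<le> card {w \<in> W. R i w}"
    and degW: "\<And>w. w \<in> W \<Longrightarrow> h \<le> card {i \<in> I. R i w}"
    and sparse: "\<And>J Y x. J \<subseteq> I \<Longrightarrow> Y \<subseteq> W \<Longrightarrow> card J \<le> x \<Longrightarrow> card Y \<le> x \<Longrightarrow> 1 \<le> x
       \<Longrightarrow> 2 * x \<le> m + 1 \<Longrightarrow> card {(i, w) \<in> J \<times> Y. R i w} < h * x"
  shows "\<exists>f. bij_betw f I W \<and> (\<forall>i\<in>I. R i (f i))"
proof -
  define N where "N i = {w \<in> W. R i w}" for i
  have "card J \<le> card (\<Union>(N ` J))" if J: "J \<subseteq> I" for J
  proof (rule ccontr)
    assume "\<not> ?thesis"
    then have less: "card (\<Union>(N ` J)) < card J" by simp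
    let ?U = "\<Union>(N ` J)"
    have finJ: "finite J" using J fin finite_subset by blast
    have U: "?U \<subseteq> W" by (auto simp: N_def)
    have finU: "finite ?U" using U fin finite_subset by blast
    show False
    proof (cases "2 * card J \<le> m + 1")
      case True
      have "{(i, w) \<in> J \<times> ?U. R i w} = (SIGMA i:J. N i)" by (auto simp: N_def)
      then have "card {(i, w) \<in> J \<times> ?U. R i w} = (\<Sum>i\<in>J. card (N i))"
        using finJ fin by (simp add: card_SigmaI N_def)
      also have "real \<dots> \<ge> (\<Sum>i\<in>J. h)"
        unfolding of_nat_sum using J degI by (intro sum_mono) (auto simp: N_def)
      finally have "h * card J \<le> card {(i, w) \<in> J \<times> ?U. R i w}" by (simp add: mult.commute)
      moreover have "card {(i, w) \<in> J \<times> ?U. R i w} < h * card J"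
        using less True by (intro sparse J U) auto
      ultimately show False by simp
    next
      case False
      have "card (W - ?U) = m - card ?U" using U finU card_eq by (simp add: card_Diff_subset)
      \<comment> \<open>\<open>Y\<close> gets one element more than \<open>I - J\<close>: then
        \<open>card Y\<close> is positive and bounds both sides, and
        \<open>2 * card J > m + 1\<close> keeps it in the range of \<open>sparse\<close>.\<close>
      then have "m - card J + 1 \<le> card (W - ?U)"
        using less J fin card_eq card_mono[OF fin(1) J] by linarith
      then obtain Y where Y: "Y \<subseteq> W - ?U" "card Y = m - card J + 1" "finite Y"
        using obtain_subset_with_card_n by metis
      let ?X = "I - J"
      have cX: "card ?X = m - card J" using J finJ card_eq by (simp add: card_Diff_subset)
      have "{(w, i). w \<in> Y \<and> i \<in> ?X \<and> R i w} = (SIGMA w:Y. {i \<in> I. R i w})"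
        using Y by (auto simp: N_def)
      moreover have "card {(i, w) \<in> ?X \<times> Y. R i w} = card {(w, i). w \<in> Y \<and> i \<in> ?X \<and> R i w}"
        by (rule bij_betw_same_card[of prod.swap]) (auto simp: bij_betw_def inj_on_def image_def)
      ultimately have "card {(i, w) \<in> ?X \<times> Y. R i w} = (\<Sum>w\<in>Y. card {i \<in> I. R i w})"
        using Y fin by (simp add: card_SigmaI)
      also have "real \<dots> \<ge> (\<Sum>w\<in>Y. h)"
        unfolding of_nat_sum using Y degW by (intro sum_mono) auto
      finally have "h * card Y \<le> card {(i, w) \<in> ?X \<times> Y. R i w}" by (simp add: mult.commute)
      moreover have "card {(i, w) \<in> ?X \<times> Y. R i w} < h * card Y"
      proof (rule sparse)
        show "2 * card Y \<le> m + 1"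
          using False Y card_mono[OF fin(1) J] card_eq by linarith
      qed (use Y cX in auto)
      ultimately show False by simp
    qed
  qed
  then obtain f where f: "inj_on f I" "\<forall>i\<in>I. f i \<in> N i"
    using hall_marriage[of I N] fin by (auto simp: N_def)
  have "f ` I = W"
    using f fin card_eq by (intro card_subset_eq) (auto simp: N_def card_image)
  then show ?thesis using f by (auto simp: bij_betw_def N_def)
qed

section \<open>Edge distribution of the random hypergraph\<close>

text \<open>Markov's inequality for the exponential of the count: by independence each element of
  \<open>A\<close> contributes \<open>1 + p * (exp l - 1)\<close> to the moment. The parameter
  \<open>l\<close> stays free.\<close>

lemma bernoulli_count_upper_tail:
  fixes p t l :: real
  assumes "finite K" "A \<subseteq> K" "0 \<le> p" "p \<le> 1" "0 \<le> l"
  shows "measure_pmf.prob (Pi_pmf K False (\<lambda>_. bernoulli_pmf p)) {f. t \<le> card {e \<in> A. f e}}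
    \<le> exp (card A * p * (exp l - 1) - l * t)"
proof -
  let ?P = "Pi_pmf K False (\<lambda>_. bernoulli_pmf p)"
  \<comment> \<open>The product runs over all of \<open>K\<close>, with trivial factors off
    \<open>A\<close>, to fit the product formula for \<open>Pi_pmf\<close>.\<close>
  define u where "u f = (\<Prod>e\<in>K. if e \<in> A \<and> f e then exp l else 1)" for f :: "'a \<Rightarrow> bool"
  have u: "u f = exp (l * card {e \<in> A. f e})" for f
  proof -
    have "u f = (\<Prod>e\<in>{e \<in> A. f e}. exp l)"
      unfolding u_def using assms
      by (intro prod.mono_neutral_cong_right) auto
    then show ?thesis by (simp add: exp_of_nat2_mult)
  qed
  have u_nonneg: "0 \<le> u f" for f by (simp add: u)
  have exp_u: "measure_pmf.expectation ?P u
      = (\<Prod>e\<in>K. measure_pmf.expectation (bernoulli_pmf p) (\<lambda>b. if e \<in> A \<and> b then exp l else 1))"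
    unfolding u_def using assms
    by (intro expectation_prod_Pi_pmf) (auto intro: integrable_measure_pmf_finite)
  also have "\<dots> = (\<Prod>e\<in>K. if e \<in> A then 1 + p * (exp l - 1) else 1)"
    using assms by (intro prod.cong) (auto simp: algebra_simps)
  also have "\<dots> = (1 + p * (exp l - 1)) ^ card A"
    using assms by (simp add: prod.If_cases Int_absorb1)
  also have "\<dots> \<le> exp (p * (exp l - 1)) ^ card A"
    using assms by (intro power_mono exp_ge_add_one_self) auto
  also have "\<dots> = exp (card A * p * (exp l - 1))"
    by (simp add: exp_of_nat_mult[symmetric] mult_ac)
  finally have E: "measure_pmf.expectation ?P u \<le> exp (card A * p * (exp l - 1))" .
  have "finite (set_pmf ?P)"
    using assms by (intro finite_subset[OF set_Pi_pmf_subset'] finite_PiE_dflt) auto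
  then have int: "integrable (measure_pmf ?P) u" by (rule integrable_measure_pmf_finite)
  have "{f. t \<le> card {e \<in> A. f e}} \<subseteq> {f \<in> space ?P. exp (l * t) \<le> u f}"
    using assms by (auto simp: u intro!: mult_left_mono)
  then have "measure_pmf.prob ?P {f. t \<le> card {e \<in> A. f e}}
      \<le> measure_pmf.prob ?P {f \<in> space ?P. exp (l * t) \<le> u f}"
    by (intro measure_pmf.finite_measure_mono) auto
  also have "\<dots> \<le> measure_pmf.expectation ?P u / exp (l * t)"
    by (intro integral_Markov_inequality_measure[where A = UNIV]) (use int in \<open>auto intro: u_nonneg\<close>)
  also have "\<dots> \<le> exp (card A * p * (exp l - 1)) / exp (l * t)"
    using E by (intro divide_right_mono) auto
  finally show ?thesis by (simp add: exp_diff)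
qed

lemma card_k_subsets: "card (k_subsets k n) = n choose k"
  unfolding k_subsets_def by (simp add: n_subsets)

lemma finite_k_subsets [simp]: "finite (k_subsets k n)"
  by (rule finite_subset[of _ "Pow {1..n}"]) (auto simp: k_subsets_def)

lemma binomial_le_power: "n choose k \<le> n ^ k"
proof (cases "k \<le> n")
  case True then show ?thesis by (rule binomial_le_pow)
qed (simp add: binomial_eq_0)

text \<open>Padding by repetition lets a union bound range over lists of length exactly
  \<open>x\<close> instead of sets of size at most \<open>x\<close>; such lists are easily
  counted.\<close>

lemma nonempty_finite_set_eq_set_list:
  assumes "finite A" "A \<noteq> {}" "card A \<le> x"
  obtains as where "set as = A" "length as = x"
proof -
  obtain bs where bs: "set bs = A" "distinct bs" using finite_distinct_list assms by blast
  then have "length bs \<le> x" using assms distinct_card by metis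
  obtain a where "a \<in> A" using assms by blast
  show thesis
    by (rule that[of "bs @ replicate (x - length bs) a"])
       (use bs \<open>a \<in> A\<close> \<open>length bs \<le> x\<close> in \<open>auto simp: set_replicate_conv_if\<close>)
qed

text \<open>As \<open>Y\<close> avoids all members of \<open>X\<close>, distinct pairs give distinct
  edges. The range \<open>2 * x \<le> m + 1\<close> is the one in which Hall's condition is tested
  from either side.\<close>

definition sparse_pairs :: "nat \<Rightarrow> 'a set \<Rightarrow> nat \<Rightarrow> real \<Rightarrow> 'a set set \<Rightarrow> bool" where
  "sparse_pairs k V m h E \<longleftrightarrow> (\<forall>X Y x. X \<subseteq> {f. f \<subseteq> V \<and> card f = k - 1} \<and> Y \<subseteq> V \<and> Y \<inter> \<Union>X = {} \<and>
     card X \<le> x \<and> card Y \<le> x \<and> 1 \<le> x \<and> 2 * x \<le> m + 1 \<longrightarrow>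
     real (card {(f, y) \<in> X \<times> Y. insert y f \<in> E}) < h * real x)"

text \<open>The pairs correspond to at most \<open>x * x\<close> distinct potential edges, so the
  tail bound for independent indicators applies. The factor \<open>x\<close> is pulled out of the
  exponent to compete with a number of choices that is also an \<open>x\<close>-th power.\<close>

lemma prob_dense_pair_le:
  fixes p h l :: real
  assumes k: "k \<ge> 2" and "0 \<le> p" "p \<le> 1" "0 \<le> l"
    and X: "X \<subseteq> k_subsets (k - 1) n" and Y: "Y \<subseteq> {1..n}" "Y \<inter> \<Union>X = {}"
    and card_le: "card X \<le> x" "card Y \<le> x"
  shows "measure_pmf.prob (Pi_pmf (k_subsets k n) False (\<lambda>_. bernoulli_pmf p))
      {f. h * x \<le> card {(g, y) \<in> X \<times> Y. insert y g \<in> {e \<in> k_subsets k n. f e}}}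
    \<le> exp (x * (x * p * (exp l - 1) - l * h))" (is "measure_pmf.prob ?P _ \<le> _")
proof -
  define A where "A = (\<lambda>(g, y). insert y g) ` (X \<times> Y)"
  have finX: "finite X" using X finite_k_subsets finite_subset by blast
  have finY: "finite Y" using Y finite_subset by blast
  have inj: "inj_on (\<lambda>(g, y). insert y g) (X \<times> Y)"
  proof (rule inj_onI, clarify)
    fix g y g' y' assume g: "g \<in> X" "y \<in> Y" "g' \<in> X" "y' \<in> Y" and eq: "insert y g = insert y' g'"
    \<comment> \<open>Since \<open>Y\<close> misses \<open>\<Union>X\<close>, intersecting the new
      edge with \<open>\<Union>X\<close> recovers \<open>g\<close>.\<close>
    have "insert y g \<inter> \<Union>X = g" "insert y' g' \<inter> \<Union>X = g'" using g Y by auto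
    then have "g = g'" using eq by simp
    moreover have "y \<notin> g" "y' \<notin> g'" using g Y by auto
    ultimately show "g = g' \<and> y = y'" using eq by auto
  qed
  have A: "A \<subseteq> k_subsets k n"
  proof
    fix e assume "e \<in> A"
    then obtain g y where g: "g \<in> X" "y \<in> Y" "e = insert y g" by (auto simp: A_def)
    then have "y \<notin> g" "g \<subseteq> {1..n}" "card g = k - 1" "y \<in> {1..n}" using X Y by (auto simp: k_subsets_def)
    moreover then have "finite g" using finite_subset by blast
    ultimately show "e \<in> k_subsets k n" using k g by (auto simp: k_subsets_def)
  qed
  have "card A = card X * card Y"
    using card_image[OF inj] finX finY by (simp add: A_def card_cartesian_product)
  also have "\<dots> \<le> x * x" using card_le by (rule mult_le_mono)
  finally have cA: "real (card A) \<le> real x * real x" by (metis of_nat_le_iff of_nat_mult)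
  have "card {(g, y) \<in> X \<times> Y. insert y g \<in> {e \<in> k_subsets k n. f e}} = card {e \<in> A. f e}" for f
  proof (rule bij_betw_same_card)
    show "bij_betw (\<lambda>(g, y). insert y g) {(g, y) \<in> X \<times> Y. insert y g \<in> {e \<in> k_subsets k n. f e}} {e \<in> A. f e}"
      unfolding bij_betw_def
    proof
      show "inj_on (\<lambda>(g, y). insert y g) {(g, y) \<in> X \<times> Y. insert y g \<in> {e \<in> k_subsets k n. f e}}"
        by (rule inj_on_subset[OF inj]) auto
      show "(\<lambda>(g, y). insert y g) ` {(g, y) \<in> X \<times> Y. insert y g \<in> {e \<in> k_subsets k n. f e}} = {e \<in> A. f e}"
        using A by (auto simp: A_def image_iff)
    qed
  qed
  then have "measure_pmf.prob ?P {f. h * x \<le> card {(g, y) \<in> X \<times> Y. insert y g \<in> {e \<in> k_subsets k n. f e}}}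
     = measure_pmf.prob ?P {f. h * x \<le> card {e \<in> A. f e}}" by simp
  also have "\<dots> \<le> exp (card A * p * (exp l - 1) - l * (h * x))"
    using assms A by (intro bernoulli_count_upper_tail) auto
  also have "\<dots> \<le> exp (x * (x * p * (exp l - 1) - l * h))"
  proof -
    have "card A * (p * (exp l - 1)) \<le> x * x * (p * (exp l - 1))"
      using cA assms by (intro mult_right_mono) auto
    then show ?thesis by (simp add: algebra_simps)
  qed
  finally show ?thesis .
qed

text \<open>Union bound: for each \<open>x\<close> there are at most \<open>(n ^ k) ^ x\<close>
  pairs of lists, each failing with probability at most \<open>exp b ^ x\<close>. By
  \<open>small\<close> the resulting power is at most its base, and at most \<open>n\<close> values
  of \<open>x\<close> occur.\<close>

lemma prob_not_sparse_pairs_le: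
  fixes p h l b :: real
  assumes k: "k \<ge> 2" and p: "0 \<le> p" "p \<le> 1" "0 \<le> l" and h: "0 < h" and m: "m \<le> n"
    and b: "\<And>x. 1 \<le> x \<Longrightarrow> 2 * x \<le> m + 1 \<Longrightarrow> real x * p * (exp l - 1) - l * h \<le> b"
    and small: "real n ^ k * exp b \<le> 1"
  shows "measure_pmf.prob (random_hypergraph k n p) {G. \<not> sparse_pairs k {1..n} m h (edges G)}
    \<le> real n * (real n ^ k * exp b)"
proof -
  let ?P = "Pi_pmf (k_subsets k n) False (\<lambda>_. bernoulli_pmf p)"
  let ?K = "k_subsets (k - 1) n"
  let ?E = "\<lambda>f. {e \<in> k_subsets k n. f e}"
  define Q where "Q x = {(xs, ys). set xs \<subseteq> ?K \<and> length xs = x \<and> set ys \<subseteq> {1..n} \<and> length ys = x \<and>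
     set ys \<inter> \<Union>(set xs) = {}}" for x
  define B where "B x q = {f. h * x \<le> card {(g, y) \<in> set (fst q) \<times> set (snd q). insert y g \<in> ?E f}}"
    for x and q :: "nat set list \<times> nat list"
  define I where "I = {x. 1 \<le> x \<and> 2 * x \<le> m + 1}"
  have I: "I \<subseteq> {1..m}" by (auto simp: I_def)
  then have finI: "finite I" using finite_subset by blast
  have Qsub: "Q x \<subseteq> {xs. set xs \<subseteq> ?K \<and> length xs = x} \<times> {ys. set ys \<subseteq> {1..n} \<and> length ys = x}" for x
    by (auto simp: Q_def)
  have finR: "finite ({xs. set xs \<subseteq> ?K \<and> length xs = x} \<times> {ys. set ys \<subseteq> {1..n} \<and> length ys = x})" for x
    by (intro finite_cartesian_product finite_lists_length_eq) auto
  have finQ: "finite (Q x)" for x using Qsub finR finite_subset by blast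
  have cardQ: "real (card (Q x)) \<le> (real n ^ k) ^ x" for x
  proof -
    have "card (Q x) \<le> card {xs. set xs \<subseteq> ?K \<and> length xs = x} * card {ys. set ys \<subseteq> {1..n} \<and> length ys = x}"
      using card_mono[OF finR Qsub] by (simp add: card_cartesian_product)
    also have "\<dots> = (n choose (k - 1)) ^ x * n ^ x"
      by (simp add: card_lists_length_eq card_k_subsets)
    also have "\<dots> \<le> (n ^ (k - 1)) ^ x * n ^ x" by (intro mult_le_mono power_mono binomial_le_power) auto
    also have "\<dots> = (n ^ k) ^ x"
      using k by (simp add: power_mult_distrib[symmetric] power_eq_if[of n k] mult.commute)
    finally have "real (card (Q x)) \<le> real ((n ^ k) ^ x)" by (rule of_nat_mono)
    then show ?thesis by simp
  qed
  have "{f. \<not> sparse_pairs k {1..n} m h (?E f)} \<subseteq> (\<Union>x\<in>I. \<Union>q\<in>Q x. B x q)"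
  proof
    fix f assume "f \<in> {f. \<not> sparse_pairs k {1..n} m h (?E f)}"
    then obtain X Y x where X: "X \<subseteq> ?K" and Y: "Y \<subseteq> {1..n}" "Y \<inter> \<Union>X = {}" and c: "card X \<le> x" "card Y \<le> x"
      and x: "1 \<le> x" "2 * x \<le> m + 1" and ge: "h * x \<le> card {(g, y) \<in> X \<times> Y. insert y g \<in> ?E f}"
      unfolding sparse_pairs_def k_subsets_def[of "k - 1" n, symmetric] mem_Collect_eq by (meson not_less)
    \<comment> \<open>Positivity of \<open>h\<close> rules out empty \<open>X\<close> or
      \<open>Y\<close>, which could not be padded to length \<open>x\<close>.\<close>
    have "0 < h * x" using h x by simp
    then have "{(g, y) \<in> X \<times> Y. insert y g \<in> ?E f} \<noteq> {}" using ge by (metis card.empty of_nat_0 not_le)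
    then have ne: "X \<noteq> {}" "Y \<noteq> {}" by auto
    have fin: "finite X" "finite Y" using X Y finite_k_subsets finite_subset by blast+
    obtain xs where xs: "set xs = X" "length xs = x" using nonempty_finite_set_eq_set_list fin ne c by metis
    obtain ys where ys: "set ys = Y" "length ys = x" using nonempty_finite_set_eq_set_list fin ne c by metis
    have "(xs, ys) \<in> Q x" "x \<in> I" using xs ys X Y x by (auto simp: Q_def I_def)
    moreover have "f \<in> B x (xs, ys)" using ge xs ys by (simp add: B_def)
    ultimately show "f \<in> (\<Union>x\<in>I. \<Union>q\<in>Q x. B x q)" by blast
  qed
  then have "measure_pmf.prob ?P {f. \<not> sparse_pairs k {1..n} m h (?E f)}
      \<le> measure_pmf.prob ?P (\<Union>x\<in>I. \<Union>q\<in>Q x. B x q)"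
    by (intro measure_pmf.finite_measure_mono) auto
  also have "\<dots> \<le> (\<Sum>x\<in>I. measure_pmf.prob ?P (\<Union>q\<in>Q x. B x q))"
    using finI by (intro measure_pmf.finite_measure_subadditive_finite) auto
  also have "\<dots> \<le> (\<Sum>x\<in>I. real n ^ k * exp b)"
  proof (intro sum_mono)
    fix x assume "x \<in> I"
    then have x: "1 \<le> x" "2 * x \<le> m + 1" by (auto simp: I_def)
    have "measure_pmf.prob ?P (\<Union>q\<in>Q x. B x q) \<le> (\<Sum>q\<in>Q x. measure_pmf.prob ?P (B x q))"
      using finQ by (intro measure_pmf.finite_measure_subadditive_finite) auto
    also have "\<dots> \<le> (\<Sum>q\<in>Q x. exp b ^ x)"
    proof (intro sum_mono)
      fix q assume "q \<in> Q x"
      then have q: "set (fst q) \<subseteq> ?K" "length (fst q) = x" "set (snd q) \<subseteq> {1..n}" "length (snd q) = x"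
        "set (snd q) \<inter> \<Union>(set (fst q)) = {}"
        by (simp_all add: Q_def case_prod_beta)
      have "measure_pmf.prob ?P (B x q) \<le> exp (x * (x * p * (exp l - 1) - l * h))"
        unfolding B_def
        by (rule prob_dense_pair_le[OF k p q(1,3,5)]) (metis q card_length)+
      also have "\<dots> \<le> exp (x * b)" using b[OF x] by (simp add: mult_left_mono)
      finally show "measure_pmf.prob ?P (B x q) \<le> exp b ^ x" by (simp add: exp_of_nat_mult)
    qed
    also have "\<dots> \<le> (real n ^ k) ^ x * exp b ^ x" using cardQ by (simp add: mult_right_mono)
    also have "\<dots> = (real n ^ k * exp b) ^ x" by (simp add: power_mult_distrib)
    also have "\<dots> \<le> (real n ^ k * exp b) ^ 1" using small x by (intro power_decreasing) auto
    finally show "measure_pmf.prob ?P (\<Union>q\<in>Q x. B x q) \<le> real n ^ k * exp b" by simp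
  qed
  also have "\<dots> = card I * (real n ^ k * exp b)" by simp
  also have "card I \<le> n" using card_mono[OF _ I] m by simp
  then have "card I * (real n ^ k * exp b) \<le> real n * (real n ^ k * exp b)"
    by (intro mult_right_mono) auto
  finally show ?thesis by (simp add: random_hypergraph_def vimage_def)
qed

section \<open>Random orderings\<close>

text \<open>The \<open>b j\<close> are the terms of the expansion of
  \<open>(t + (n - t)) ^ n\<close>. Their ratios, stated without division in \<open>rec\<close>,
  show that they rise up to \<open>j = t\<close> and fall afterwards, so none of the
  \<open>n + 1\<close> terms exceeds \<open>b t\<close>.\<close>

lemma power_self_le_binomial_mode:
  fixes n t :: nat
  assumes t: "t \<le> n"
  shows "n ^ n \<le> (n + 1) * ((n choose t) * t ^ t * (n - t) ^ (n - t))"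
proof -
  define b where "b j = (n choose j) * t ^ j * (n - t) ^ (n - j)" for j
  have rec: "b (Suc j) * (Suc j * (n - t)) = b j * ((n - j) * t)" if "j < n" for j
  proof -
    have 1: "Suc j * (n choose Suc j) = (n choose j) * (n - j)"
      using binomial_absorb_comp[of n j] binomial_absorption[of j n] by (simp add: mult.commute)
    have 2: "(n - t) * (n - t) ^ (n - Suc j) = (n - t) ^ (n - j)"
      using that by (metis Suc_diff_Suc power_Suc)
    have "b (Suc j) * (Suc j * (n - t))
        = (Suc j * (n choose Suc j)) * t ^ Suc j * ((n - t) * (n - t) ^ (n - Suc j))"
      unfolding b_def by (simp only: mult_ac)
    also have "\<dots> = b j * ((n - j) * t)"
      unfolding 1 2 by (simp only: b_def power_Suc mult_ac)
    finally show ?thesis .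
  qed
  have up: "b j \<le> b (Suc j)" if "j < t" for j
  proof (cases "n = t")
    \<comment> \<open>Here \<open>n - t\<close> is zero and cannot be cancelled, but
      \<open>b j\<close> vanishes through the factor \<open>0 ^ (n - j)\<close>.\<close>
    case True then show ?thesis using that by (simp add: b_def power_0_left)
  next
    case False
    have "Suc j * (n - t) \<le> t * (n - j)" using that by (intro mult_le_mono) auto
    then have "b j * (Suc j * (n - t)) \<le> b j * ((n - j) * t)"
      by (intro mult_le_mono2) (simp add: mult.commute)
    also have "\<dots> = b (Suc j) * (Suc j * (n - t))" using that t by (intro rec[symmetric]) simp
    finally show ?thesis using False t by (subst (asm) mult_le_cancel2) auto
  qed
  have down: "b (Suc j) \<le> b j" if "t \<le> j" "j < n" for j
  proof -
    have "t * (n - j) \<le> Suc j * (n - t)" using that by (intro mult_le_mono) auto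
    moreover have "b (Suc j) * (Suc j * (n - t)) = b j * ((n - j) * t)" using rec that by simp
    ultimately have "b (Suc j) * (Suc j * (n - t)) \<le> b j * (Suc j * (n - t))"
      by (simp only: mult.commute[of "n - j" t] mult_le_mono2)
    then show ?thesis using that by (subst (asm) mult_le_cancel2) auto
  qed
  have "b j \<le> b t" if "j \<le> n" for j
  proof (cases "j \<le> t")
    case True then show ?thesis
      by (induction rule: inc_induct) (auto intro: up order_trans)
  next
    case False
    then have "t \<le> j" by simp
    then show ?thesis using that
      by (induction rule: dec_induct) (auto intro: order_trans[OF down])
  qed
  then have "(\<Sum>j\<le>n. b j) \<le> (\<Sum>j\<le>n. b t)" by (intro sum_mono) auto
  moreover have "(\<Sum>j\<le>n. b j) = (t + (n - t)) ^ n" by (simp add: binomial b_def)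
  ultimately show ?thesis using t by (simp add: b_def)
qed

text \<open>A consequence of \<open>exp l \<ge> 1 + l\<close>, used to replace
  \<open>1 - exp (- l)\<close> in the tail bounds by a polynomial.\<close>

lemma one_minus_exp_minus_ge:
  fixes l :: real assumes "0 \<le> l"
  shows "l - l\<^sup>2 \<le> 1 - exp (- l)"
proof -
  have "exp (- l) \<le> 1 / (1 + l)"
    using assms exp_ge_add_one_self[of l] by (simp add: exp_minus field_simps)
  also have "\<dots> \<le> 1 - (l - l\<^sup>2)"
    using assms by (simp add: field_simps power2_eq_square)
  finally show ?thesis by simp
qed

text \<open>Comparing with independent sampling costs only the factor \<open>n + 1\<close>, because a binomial
  variable with mean \<open>n - t\<close> attains that value with probability at least \<open>1 / (n + 1)\<close>.\<close>

lemma hypergeometric_lower_tail: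
  fixes V A :: "'a set" and l a :: real
  assumes V: "finite V" "card V = n" "0 < n" and t: "t \<le> n" and A: "A \<subseteq> V" and l: "0 \<le> l"
  shows "card {Q. Q \<subseteq> V \<and> card Q = t \<and> card (A - Q) < a}
    \<le> (n choose t) * ((real n + 1) * exp (l * a - real (n - t) / n * (1 - exp (- l)) * card A))"
proof -
  \<comment> \<open>If each vertex enters \<open>Q\<close> independently with probability
    \<open>t / n\<close>, then \<open>q\<close> is the chance of staying out and \<open>?w\<close>
    the probability of any particular \<open>t\<close>-set.\<close>
  define q where "q = real (n - t) / n"
  have q: "0 \<le> q" "q \<le> 1" "1 - q = t / n" using V t by (auto simp: q_def field_simps of_nat_diff)
  let ?B = "{Q. Q \<subseteq> V \<and> card Q = t \<and> card (A - Q) < a}"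
  let ?w = "(1 - q) ^ t * q ^ (n - t)"
  \<comment> \<open>The weight of a vertex outside \<open>Q\<close>, tilted on \<open>A\<close> so
    that large values of \<open>card (A - Q)\<close> are penalised.\<close>
  define g where "g x = q * (if x \<in> A then exp (- l) else 1)" for x
  have g0: "0 \<le> g x" for x using q by (simp add: g_def)
  have finB: "finite ?B" by (rule finite_subset[of _ "Pow V"]) (use V in auto)
  have weight_ge: "(\<Prod>x\<in>Q. 1 - q) * (\<Prod>x\<in>V - Q. g x) \<ge> ?w * exp (- l * a)" if Q: "Q \<in> ?B" for Q
  proof -
    have finQ: "finite Q" using Q V finite_subset by blast
    have "(\<Prod>x\<in>V - Q. g x) = q ^ card (V - Q) * (\<Prod>x\<in>V - Q. if x \<in> A then exp (- l) else 1)"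
      by (simp add: g_def prod.distrib)
    also have "(\<Prod>x\<in>V - Q. if x \<in> A then exp (- l) else 1) = (\<Prod>x\<in>A - Q. exp (- l))"
      using V A by (intro prod.mono_neutral_cong_right) auto
    also have "\<dots> = exp (- l * card (A - Q))" by (simp add: exp_of_nat2_mult[symmetric])
    also have "card (V - Q) = n - t" using Q V finQ by (simp add: card_Diff_subset)
    finally have *: "(\<Prod>x\<in>Q. 1 - q) * (\<Prod>x\<in>V - Q. g x) = ?w * exp (- l * card (A - Q))"
      using Q by simp
    have "exp (- l * a) \<le> exp (- l * card (A - Q))"
      using Q l by (auto intro: mult_left_mono)
    then show ?thesis unfolding * using q by (intro mult_left_mono) auto
  qed
  have "card ?B * (?w * exp (- l * a)) = (\<Sum>Q\<in>?B. ?w * exp (- l * a))" by simp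
  also have "\<dots> \<le> (\<Sum>Q\<in>?B. (\<Prod>x\<in>Q. 1 - q) * (\<Prod>x\<in>V - Q. g x))"
    by (rule sum_mono) (rule weight_ge)
  \<comment> \<open>Dropping the condition \<open>card Q = t\<close> makes the sum factor over the
    vertices.\<close>
  also have "\<dots> \<le> (\<Sum>Q\<in>Pow V. (\<Prod>x\<in>Q. 1 - q) * (\<Prod>x\<in>V - Q. g x))"
    using V q g0 by (intro sum_mono2) (auto intro!: mult_nonneg_nonneg prod_nonneg)
  also have "\<dots> = (\<Prod>x\<in>V. 1 - q + g x)" using V by (simp add: prod_add)
  also have "\<dots> = (\<Prod>x\<in>V. if x \<in> A then 1 - q * (1 - exp (- l)) else 1)"
    by (intro prod.cong) (auto simp: g_def algebra_simps)
  also have "\<dots> = (1 - q * (1 - exp (- l))) ^ card A"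
    using V A by (simp add: prod.If_cases Int_absorb1)
  also have "\<dots> \<le> exp (- (q * (1 - exp (- l)))) ^ card A"
  proof (rule power_mono)
    show "1 - q * (1 - exp (- l)) \<le> exp (- (q * (1 - exp (- l))))"
      using exp_ge_add_one_self[of "- (q * (1 - exp (- l)))"] by simp
    show "0 \<le> 1 - q * (1 - exp (- l))" using q l by (simp add: mult_le_one)
  qed
  also have "\<dots> = exp (- q * (1 - exp (- l)) * card A)" by (simp add: exp_of_nat2_mult[symmetric])
  finally have main: "card ?B * (?w * exp (- l * a)) \<le> exp (- q * (1 - exp (- l)) * card A)" .
  have mode: "1 \<le> (real n + 1) * (n choose t) * ?w"
  proof -
    have "real n ^ n \<le> (real n + 1) * ((n choose t) * real t ^ t * real (n - t) ^ (n - t))"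
      using of_nat_mono[OF power_self_le_binomial_mode[OF t], where ?'a = real]
      by (simp del: of_nat_diff add: distrib_right)
    moreover have "real n ^ n = real n ^ t * real n ^ (n - t)" using t by (simp add: power_add[symmetric])
    moreover have w: "?w = real t ^ t * real (n - t) ^ (n - t) / (real n ^ t * real n ^ (n - t))"
      unfolding q(3) by (simp add: q_def power_divide del: of_nat_diff)
    ultimately show ?thesis unfolding w using V by (simp add: field_simps del: of_nat_diff)
  qed
  have "real (card ?B) \<le> card ?B * ((real n + 1) * (n choose t) * ?w)"
    using mode by (intro mult_le_cancel_left1[THEN iffD2]) auto
  also have "\<dots> = card ?B * (?w * exp (- l * a)) * ((n choose t) * ((real n + 1) * exp (l * a)))"
  proof -
    have "card ?B * (?w * exp (- l * a)) * ((n choose t) * ((real n + 1) * exp (l * a)))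
        = card ?B * ((real n + 1) * (n choose t) * ?w) * (exp (- l * a) * exp (l * a))"
      by (simp only: mult_ac)
    also have "exp (- l * a) * exp (l * a) = 1" by (simp add: exp_add[symmetric])
    finally show ?thesis by (simp only: mult_1_right)
  qed
  also have "\<dots> \<le> exp (- q * (1 - exp (- l)) * card A) * ((n choose t) * ((real n + 1) * exp (l * a)))"
    using main by (intro mult_right_mono) auto
  also have "\<dots> = (n choose t) * ((real n + 1) * (exp (l * a) * exp (- q * (1 - exp (- l)) * card A)))"
    by (simp only: mult_ac)
  also have "exp (l * a) * exp (- q * (1 - exp (- l)) * card A) = exp (l * a - q * (1 - exp (- l)) * card A)"
    by (simp add: exp_add[symmetric])
  finally show ?thesis by (simp add: q_def)
qed

section \<open>Prefixes of a uniformly random ordering\<close>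

text \<open>The random ordering is handled by counting: a probability about its first
  \<open>t\<close> vertices is a number of such lists divided by
  \<open>card (distinct_lists V t)\<close>.\<close>

definition distinct_lists :: "'a set \<Rightarrow> nat \<Rightarrow> 'a list set" where
  "distinct_lists V t = {xs. length xs = t \<and> distinct xs \<and> set xs \<subseteq> V}"

lemma finite_distinct_lists: "finite V \<Longrightarrow> finite (distinct_lists V t)"
  unfolding distinct_lists_def
  by (rule finite_subset[OF _ finite_lists_length_eq[of V t]]) auto

lemma sum_distinct_lists_Suc:
  assumes "finite V"
  shows "(\<Sum>xs\<in>distinct_lists V (Suc t). f xs) = (\<Sum>xs\<in>distinct_lists V t. \<Sum>x\<in>V - set xs. f (xs @ [x]))"
proof -
  have "(\<Sum>xs\<in>distinct_lists V t. \<Sum>x\<in>V - set xs. f (xs @ [x]))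
      = (\<Sum>(xs, x)\<in>Sigma (distinct_lists V t) (\<lambda>xs. V - set xs). f (xs @ [x]))"
    using assms by (intro sum.Sigma) (auto intro: finite_distinct_lists)
  also have "\<dots> = (\<Sum>xs\<in>distinct_lists V (Suc t). f xs)"
  proof (rule sum.reindex_bij_witness[of _ "\<lambda>ys. (butlast ys, last ys)" "\<lambda>(xs, x). xs @ [x]"])
    fix ys assume "ys \<in> distinct_lists V (Suc t)"
    moreover then obtain xs x where "ys = xs @ [x]" by (auto simp: distinct_lists_def length_Suc_conv_rev)
    ultimately show "(\<lambda>(xs, x). xs @ [x]) (butlast ys, last ys) = ys"
      and "(butlast ys, last ys) \<in> Sigma (distinct_lists V t) (\<lambda>xs. V - set xs)"
      by (auto simp: distinct_lists_def)
  qed (auto simp: distinct_lists_def)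
  finally show ?thesis ..
qed

text \<open>Each \<open>t\<close>-set has \<open>fact t\<close> orderings, so the first
  \<open>t\<close> vertices of a random ordering form a uniform \<open>t\<close>-set. This carries
  the hypergeometric bound over to prefixes.\<close>

lemma card_distinct_lists_set:
  assumes "finite V"
  shows "card {xs \<in> distinct_lists V t. P (set xs)} = fact t * card {Q. Q \<subseteq> V \<and> card Q = t \<and> P Q}"
proof -
  let ?Q = "{Q. Q \<subseteq> V \<and> card Q = t \<and> P Q}"
  have finQ: "finite ?Q" by (rule finite_subset[of _ "Pow V"]) (use assms in auto)
  have "{xs \<in> distinct_lists V t. P (set xs)} = (\<Union>Q\<in>?Q. permutations_of_set Q)"
    by (auto simp: distinct_lists_def permutations_of_set_def distinct_card)
  also have "card \<dots> = (\<Sum>Q\<in>?Q. card (permutations_of_set Q))"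
    using finQ by (intro card_UN_disjoint) (simp, simp, auto simp: permutations_of_set_def)
  also have "\<dots> = (\<Sum>Q\<in>?Q. fact t)"
    using finite_subset[OF _ assms] by (intro sum.cong) auto
  finally show ?thesis by simp
qed

lemma card_distinct_lists:
  assumes "finite V"
  shows "card (distinct_lists V t) = fact t * (card V choose t)"
  using card_distinct_lists_set[OF assms, of t "\<lambda>_. True"] assms by (simp add: n_subsets)

lemma card_distinct_lists_Suc:
  assumes "finite V"
  shows "card (distinct_lists V (Suc t)) = (card V - t) * card (distinct_lists V t)"
proof -
  have "card (distinct_lists V (Suc t)) = (\<Sum>xs\<in>distinct_lists V t. card (V - set xs))"
    using sum_distinct_lists_Suc[OF assms, of "\<lambda>_. 1 :: nat" t] by simp
  also have "\<dots> = (\<Sum>xs\<in>distinct_lists V t. card V - t)"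
    by (intro sum.cong) (auto simp: distinct_lists_def card_Diff_subset distinct_card)
  finally show ?thesis by simp
qed

section \<open>Exposing an ordering vertex by vertex and block by block\<close>

locale codegree_ordering =
  fixes V :: "'a set" and E :: "'a set set" and k :: nat and c :: real
  assumes finV: "finite V" and k2: "k \<ge> 2"
begin

definition nbh :: "'a set \<Rightarrow> 'a set" where
  "nbh S = {v \<in> V - S. insert v S \<in> E}"

text \<open>With \<open>Q\<close> the set of vertices already exposed, \<open>c\<close> bounds from
  below the chance that the next vertex lies in \<open>nbh S\<close>.\<close>

definition rich_avoiding :: "'a set \<Rightarrow> bool" where
  "rich_avoiding Q \<longleftrightarrow> (\<forall>S. S \<subseteq> V \<and> card S = k - 1 \<longrightarrow> c * real (card V - card Q) \<le> card (nbh S - Q))"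

text \<open>All prefixes are included, so the property is inherited by prefixes and is available at
  every step of the exposure.\<close>

definition rich :: "'a list \<Rightarrow> bool" where
  "rich xs \<longleftrightarrow> (\<forall>t\<le>length xs. rich_avoiding (set (take t xs)))"

definition block :: "nat \<Rightarrow> 'a list \<Rightarrow> 'a set" where
  "block i xs = (!) xs ` {(k - 1) * i..<(k - 1) * (i + 1)}"

text \<open>Counting only completed blocks makes the number a function of the prefix exposed so
  far.\<close>

definition hits :: "'a \<Rightarrow> 'a list \<Rightarrow> nat" where
  "hits v xs = card {i. (k - 1) * (i + 1) \<le> length xs \<and> insert v (block i xs) \<in> E}"

lemma nbh_subset: "nbh S \<subseteq> V"
  by (auto simp: nbh_def)

lemma rich_snoc: "rich (xs @ [x]) \<longleftrightarrow> rich xs \<and> rich_avoiding (set (xs @ [x]))"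
proof -
  have "(\<forall>t\<le>Suc (length xs). P t) \<longleftrightarrow> (\<forall>t\<le>length xs. P t) \<and> P (Suc (length xs))" for P
    by (auto simp: le_Suc_eq)
  then show ?thesis unfolding rich_def by simp
qed

lemma rich_imp_rich_avoiding: "rich xs \<Longrightarrow> rich_avoiding (set xs)"
  unfolding rich_def by (metis order_refl take_all)

lemma finite_block_indices: "finite {i. (k - 1) * (i + 1) \<le> t \<and> P i}"
proof (rule finite_subset)
  show "{i. (k - 1) * (i + 1) \<le> t \<and> P i} \<subseteq> {..t}"
  proof clarify
    fix i assume "(k - 1) * (i + 1) \<le> t"
    moreover have "1 * (i + 1) \<le> (k - 1) * (i + 1)" using k2 by (intro mult_le_mono1) simp
    ultimately show "i \<le> t" by simp
  qed
qed simp

lemma block_snoc: "(k - 1) * (i + 1) \<le> length xs \<Longrightarrow> block i (xs @ [x]) = block i xs"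
  unfolding block_def by (intro image_cong) (auto simp: nth_append)

lemma block_indices_snoc:
  "{i. (k - 1) * (i + 1) \<le> length xs \<and> insert v (block i xs) \<in> E}
    \<subseteq> {i. (k - 1) * (i + 1) \<le> length (xs @ [x]) \<and> insert v (block i (xs @ [x])) \<in> E}"
  using block_snoc by auto

lemma hits_snoc_mono: "hits v xs \<le> hits v (xs @ [x])"
  unfolding hits_def by (rule card_mono[OF finite_block_indices block_indices_snoc])

text \<open>The \<open>k - 2\<close> entries before the one that completes a block are known in
  advance; with a vertex \<open>v\<close> they fix the set whose neighbourhood the last entry should
  meet.\<close>

lemma block_snoc_last:
  assumes "Suc (length xs) = (k - 1) * (i + 1)"
  shows "block i (xs @ [x]) = insert x (set (drop (length xs - (k - 2)) xs))"
proof -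
  have le: "(k - 1) * i + (k - 1) = Suc (length xs)" using assms by simp
  then have len: "length xs - (k - 2) = (k - 1) * i" "(k - 1) * i \<le> length xs" using k2 by linarith+
  then have "{(k - 1) * i..<(k - 1) * (i + 1)} = insert (length xs) {(k - 1) * i..<length xs}"
    unfolding assms[symmetric] by (simp add: atLeastLessThanSuc)
  then have "block i (xs @ [x]) = insert x ((!) xs ` {(k - 1) * i..<length xs})"
    unfolding block_def by (auto simp: nth_append image_iff)
  also have "(!) xs ` {(k - 1) * i..<length xs} = set (drop ((k - 1) * i) xs)"
  proof -
    have "{(k - 1) * i..<length xs} = (\<lambda>j. (k - 1) * i + j) ` {0..<length xs - (k - 1) * i}"
      using len by (simp add: image_add_atLeastLessThan)
    then have "(!) xs ` {(k - 1) * i..<length xs} = (\<lambda>j. xs ! ((k - 1) * i + j)) ` {0..<length xs - (k - 1) * i}"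
      by (simp only: image_image)
    then show ?thesis
      using nth_image[of "length (drop ((k - 1) * i) xs)" "drop ((k - 1) * i) xs"] len
      by simp
  qed
  finally show ?thesis using len by simp
qed

text \<open>The block completed by \<open>x\<close> has an index not yet counted for
  \<open>xs\<close>, and together with \<open>v\<close> it is \<open>insert x S\<close>.\<close>

lemma hits_snoc_ge:
  assumes dvd: "(k - 1) dvd Suc (length xs)"
    and S: "S = insert v (set (drop (length xs - (k - 2)) xs))" and x: "insert x S \<in> E"
  shows "hits v xs + 1 \<le> hits v (xs @ [x])"
proof -
  obtain j where j: "Suc (length xs) = (k - 1) * j" using dvd by blast
  then obtain i where i: "j = i + 1" by (cases j) auto
  have "insert v (block i (xs @ [x])) \<in> E"
    using x S block_snoc_last[of xs i x] i j by (simp add: insert_commute)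
  then have "insert i {i. (k - 1) * (i + 1) \<le> length xs \<and> insert v (block i xs) \<in> E}
      \<subseteq> {i. (k - 1) * (i + 1) \<le> length (xs @ [x]) \<and> insert v (block i (xs @ [x])) \<in> E}"
    using block_indices_snoc[of xs v x] j i by auto
  then have "card (insert i {i. (k - 1) * (i + 1) \<le> length xs \<and> insert v (block i xs) \<in> E}) \<le> hits v (xs @ [x])"
    unfolding hits_def by (rule card_mono[OF finite_block_indices])
  moreover have "\<not> (k - 1) * (i + 1) \<le> length xs" using j i by simp
  ultimately show ?thesis
    unfolding hits_def using finite_block_indices by (subst (asm) card_insert_disjoint) auto
qed

section \<open>Exponential moments of the hit counts\<close>

definition weight :: "real \<Rightarrow> 'a \<Rightarrow> nat \<Rightarrow> real" where
  "weight l v t = (\<Sum>xs\<in>distinct_lists V t. if rich xs \<and> v \<notin> set xs then exp (- l * hits v xs) else 0)"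

text \<open>When a block is completed, richness puts at least a proportion \<open>c\<close> of the
  possible last entries into one neighbourhood, and each of these costs a factor
  \<open>exp (- l)\<close>. The average factor is thus at most
  \<open>1 - (1 - exp (- l)) * c\<close>. At other steps no single term grows.\<close>

lemma weight_Suc:
  assumes l: "0 \<le> l" and v: "v \<in> V"
  shows "weight l v (Suc t) \<le> real (card V - t) *
    (if (k - 1) dvd Suc t then exp (- ((1 - exp (- l)) * c)) else 1) * weight l v t"
proof -
  let ?\<rho> = "if (k - 1) dvd Suc t then exp (- ((1 - exp (- l)) * c)) else 1"
  let ?f = "\<lambda>xs. if rich xs \<and> v \<notin> set xs then exp (- l * hits v xs) else 0"
  have step: "(\<Sum>x\<in>V - set xs. ?f (xs @ [x])) \<le> real (card V - t) * ?\<rho> * ?f xs"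
    if xs: "xs \<in> distinct_lists V t" for xs
  proof (cases "rich xs \<and> v \<notin> set xs")
    case False
    then have "?f (xs @ [x]) = 0" for x by (auto simp: rich_snoc)
    then show ?thesis using False by simp
  next
    case True
    have xs': "length xs = t" "distinct xs" "set xs \<subseteq> V" using xs by (auto simp: distinct_lists_def)
    have cs: "card (set xs) = t" using xs' distinct_card by blast
    have cV: "card (V - set xs) = card V - t"
      using xs' cs by (simp add: card_Diff_subset)
    show ?thesis
    proof (cases "(k - 1) dvd Suc t")
      case False
      have "(\<Sum>x\<in>V - set xs. ?f (xs @ [x])) \<le> (\<Sum>x\<in>V - set xs. ?f xs)"
      proof (rule sum_mono)
        fix x
        have "exp (- l * hits v (xs @ [x])) \<le> exp (- l * hits v xs)"
          using hits_snoc_mono[of v xs x] l by (simp add: mult_left_mono)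
        then show "?f (xs @ [x]) \<le> ?f xs" using True by simp
      qed
      then show ?thesis using False cV by simp
    next
      case dvd: True
      \<comment> \<open>The candidate edge without the entry still to be exposed. It depends only on
        \<open>xs\<close> and \<open>v\<close>, so richness of \<open>xs\<close> applies to
        it.\<close>
      define S where "S = insert v (set (drop (length xs - (k - 2)) xs))"
      define \<theta> where "\<theta> = 1 - exp (- l)"
      have "k - 1 \<le> Suc t" using dvd by (simp add: dvd_imp_le)
      then have "length (drop (length xs - (k - 2)) xs) = k - 2" using xs' by simp
      moreover have "distinct (drop (length xs - (k - 2)) xs)" using xs' by simp
      ultimately have "card (set (drop (length xs - (k - 2)) xs)) = k - 2" using distinct_card by metis
      moreover have "v \<notin> set (drop (length xs - (k - 2)) xs)" using True in_set_dropD by metis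
      ultimately have "card S = k - 1" unfolding S_def using k2 by simp
      moreover have "S \<subseteq> V" unfolding S_def using v xs' set_drop_subset by fastforce
      ultimately have rS: "c * real (card V - t) \<le> card (nbh S - set xs)"
        using True rich_imp_rich_avoiding[of xs] cs by (auto simp: rich_avoiding_def)
      have "(\<Sum>x\<in>V - set xs. ?f (xs @ [x])) \<le> (\<Sum>x\<in>V - set xs. ?f xs * (1 - \<theta> * (if x \<in> nbh S then 1 else 0)))"
      proof (rule sum_mono)
        fix x
        have "exp (- l * hits v (xs @ [x])) \<le> exp (- l * hits v xs) * (1 - \<theta> * (if x \<in> nbh S then 1 else 0))"
        proof (cases "x \<in> nbh S")
          case xS: True
          then have "hits v xs + 1 \<le> hits v (xs @ [x])"
            using dvd xs' by (intro hits_snoc_ge[OF _ S_def]) (auto simp: nbh_def)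
          then have "l * (real (hits v xs) + 1) \<le> l * hits v (xs @ [x])"
            using l by (intro mult_left_mono) auto
          then have "exp (- l * hits v (xs @ [x])) \<le> exp (- l * hits v xs + - l)"
            by (simp add: algebra_simps)
          then show ?thesis using xS by (simp add: exp_add \<theta>_def exp_diff exp_minus field_simps)
        next
          case False
          then show ?thesis using hits_snoc_mono[of v xs x] l by (simp add: mult_left_mono)
        qed
        moreover have "0 \<le> exp (- l * hits v xs) * (1 - \<theta> * (if x \<in> nbh S then 1 else 0))"
          by (simp add: \<theta>_def)
        ultimately show "?f (xs @ [x]) \<le> ?f xs * (1 - \<theta> * (if x \<in> nbh S then 1 else 0))"
          using True by simp
      qed
      also have "\<dots> = ?f xs * (real (card V - t) - \<theta> * (\<Sum>x\<in>V - set xs. if x \<in> nbh S then 1 else 0))"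
        by (simp only: sum_distrib_left[symmetric] sum_subtractf sum_constant cV mult_1_right)
      also have "(\<Sum>x\<in>V - set xs. if x \<in> nbh S then 1 else 0 :: real) = card (nbh S - set xs)"
      proof -
        have "(V - set xs) \<inter> nbh S = nbh S - set xs" using nbh_subset by blast
        then show ?thesis using finV by (simp add: sum.If_cases)
      qed
      also have "?f xs * (real (card V - t) - \<theta> * card (nbh S - set xs))
          \<le> ?f xs * (real (card V - t) * exp (- (\<theta> * c)))"
      proof (rule mult_left_mono)
        have "\<theta> * (c * real (card V - t)) \<le> \<theta> * card (nbh S - set xs)"
          using rS l by (intro mult_left_mono) (auto simp: \<theta>_def)
        moreover have "real (card V - t) * (1 - \<theta> * c) \<le> real (card V - t) * exp (- (\<theta> * c))"
          using exp_ge_add_one_self[of "- (\<theta> * c)"] by (intro mult_left_mono) auto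
        ultimately show "real (card V - t) - \<theta> * card (nbh S - set xs) \<le> real (card V - t) * exp (- (\<theta> * c))"
          by (simp add: algebra_simps)
      qed simp
      finally show ?thesis using dvd by (simp add: \<theta>_def mult_ac)
    qed
  qed
  have "weight l v (Suc t) = (\<Sum>xs\<in>distinct_lists V t. \<Sum>x\<in>V - set xs. ?f (xs @ [x]))"
    unfolding weight_def by (rule sum_distinct_lists_Suc[OF finV])
  also have "\<dots> \<le> (\<Sum>xs\<in>distinct_lists V t. real (card V - t) * ?\<rho> * ?f xs)"
    by (rule sum_mono) (rule step)
  also have "\<dots> = real (card V - t) * ?\<rho> * weight l v t"
    unfolding weight_def by (rule sum_distrib_left[symmetric])
  finally show ?thesis .
qed

text \<open>Iteration of the one-step bound: exactly \<open>t div (k - 1)\<close> of the first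
  \<open>t\<close> steps complete a block.\<close>

lemma weight_le:
  assumes l: "0 \<le> l" and v: "v \<in> V"
  shows "weight l v t \<le> card (distinct_lists V t) * exp (- ((1 - exp (- l)) * c) * (t div (k - 1)))"
proof (induction t)
  case 0
  have "weight l v 0 \<le> (\<Sum>xs\<in>distinct_lists V 0. 1)"
    unfolding weight_def using l by (intro sum_mono) auto
  then show ?case by simp
next
  case (Suc t)
  let ?a = "- ((1 - exp (- l)) * c)"
  let ?\<rho> = "if (k - 1) dvd Suc t then exp ?a else 1"
  have "weight l v (Suc t) \<le> real (card V - t) * ?\<rho> * weight l v t"
    by (rule weight_Suc[OF l v])
  also have "\<dots> \<le> real (card V - t) * ?\<rho> * (card (distinct_lists V t) * exp (?a * (t div (k - 1))))"
    by (intro mult_left_mono Suc) auto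
  also have "\<dots> = card (distinct_lists V (Suc t)) * (?\<rho> * exp (?a * (t div (k - 1))))"
    by (simp add: card_distinct_lists_Suc[OF finV])
  also have "?\<rho> * exp (?a * (t div (k - 1))) = exp (?a * (Suc t div (k - 1)))"
    by (simp add: div_Suc dvd_eq_mod_eq_0 exp_add[symmetric] algebra_simps)
  finally show ?case .
qed

text \<open>Markov's inequality for \<open>exp (- l * hits v xs)\<close>, in counting form.\<close>

lemma card_few_hits_le:
  fixes h :: real
  assumes l: "0 \<le> l" and v: "v \<in> V"
  shows "card {xs \<in> distinct_lists V t. rich xs \<and> v \<notin> set xs \<and> hits v xs < h}
    \<le> card (distinct_lists V t) * exp (l * h - (1 - exp (- l)) * c * (t div (k - 1)))"
proof -
  let ?B = "{xs \<in> distinct_lists V t. rich xs \<and> v \<notin> set xs \<and> hits v xs < h}"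
  have "card ?B * exp (- l * h) = (\<Sum>xs\<in>?B. exp (- l * h))" by simp
  also have "\<dots> \<le> (\<Sum>xs\<in>?B. if rich xs \<and> v \<notin> set xs then exp (- l * hits v xs) else 0)"
    using l by (intro sum_mono) (auto intro: mult_left_mono)
  also have "\<dots> \<le> weight l v t"
    unfolding weight_def by (intro sum_mono2 finite_distinct_lists finV) auto
  also have "\<dots> \<le> card (distinct_lists V t) * exp (- ((1 - exp (- l)) * c) * (t div (k - 1)))"
    by (rule weight_le[OF l v])
  finally have "card ?B * exp (- l * h) * exp (l * h)
      \<le> card (distinct_lists V t) * exp (- ((1 - exp (- l)) * c) * (t div (k - 1))) * exp (l * h)"
    by (intro mult_right_mono) auto
  then show ?thesis by (simp add: mult.assoc exp_add[symmetric] add.commute)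
qed

section \<open>Existence of a balanced ordering\<close>

text \<open>Union bound over the \<open>t + 1\<close> prefixes. Every list of length
  \<open>t\<close> has the same number of one-vertex extensions, so proportions of bad prefixes
  carry over to longer lists.\<close>

lemma card_not_rich_le:
  fixes \<eta> :: real
  assumes "\<And>j. j \<le> t \<Longrightarrow> card {xs \<in> distinct_lists V j. \<not> rich_avoiding (set xs)} \<le> card (distinct_lists V j) * \<eta>"
  shows "card {xs \<in> distinct_lists V t. \<not> rich xs} \<le> card (distinct_lists V t) * ((t + 1) * \<eta>)"
  using assms
proof (induction t)
  case 0
  have "{xs \<in> distinct_lists V 0. \<not> rich xs} = {xs \<in> distinct_lists V 0. \<not> rich_avoiding (set xs)}"
    by (auto simp: distinct_lists_def rich_def)
  then show ?case using 0 by simp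
next
  case (Suc t)
  let ?L = "distinct_lists V"
  let ?g = "\<lambda>xs. if \<not> rich xs then 1 else 0 :: real"
  let ?g' = "\<lambda>xs. if \<not> rich_avoiding (set xs) then 1 else 0 :: real"
  have cnt: "card {xs \<in> ?L j. P xs} = (\<Sum>xs\<in>?L j. if P xs then 1 else 0 :: real)" for j P
    using finite_distinct_lists[OF finV, of j] by (simp add: sum.If_cases Collect_conj_eq)
  have "card {xs \<in> ?L (Suc t). \<not> rich xs} = (\<Sum>xs\<in>?L t. \<Sum>x\<in>V - set xs. ?g (xs @ [x]))"
    unfolding cnt by (rule sum_distinct_lists_Suc[OF finV])
  also have "\<dots> \<le> (\<Sum>xs\<in>?L t. \<Sum>x\<in>V - set xs. ?g xs + ?g' (xs @ [x]))"
    by (intro sum_mono) (auto simp: rich_snoc)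
  also have "\<dots> = (\<Sum>xs\<in>?L t. \<Sum>x\<in>V - set xs. ?g xs) + (\<Sum>xs\<in>?L (Suc t). ?g' xs)"
    by (simp only: sum.distrib sum_distinct_lists_Suc[OF finV])
  also have "(\<Sum>xs\<in>?L t. \<Sum>x\<in>V - set xs. ?g xs) = (\<Sum>xs\<in>?L t. real (card V - t) * ?g xs)"
  proof (intro sum.cong refl)
    fix xs assume "xs \<in> ?L t"
    then have "card (V - set xs) = card V - t"
      by (auto simp: distinct_lists_def card_Diff_subset distinct_card)
    then show "(\<Sum>x\<in>V - set xs. ?g xs) = real (card V - t) * ?g xs" by simp
  qed
  also have "\<dots> = real (card V - t) * card {xs \<in> ?L t. \<not> rich xs}"
    unfolding cnt by (rule sum_distrib_left[symmetric])
  also have "\<dots> \<le> real (card V - t) * (card (?L t) * ((t + 1) * \<eta>))"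
    using Suc.IH[OF Suc.prems] by (intro mult_left_mono) (simp_all add: add.commute)
  also have "\<dots> = card (?L (Suc t)) * ((t + 1) * \<eta>)"
    by (simp add: card_distinct_lists_Suc[OF finV])
  also have "(\<Sum>xs\<in>?L (Suc t). ?g' xs) \<le> card (?L (Suc t)) * \<eta>"
    using Suc.prems[of "Suc t"] unfolding cnt[symmetric] by simp
  finally show ?case by (simp add: algebra_simps)
qed

text \<open>The hypergeometric tail bound is applied to \<open>nbh S\<close> for each of the at most
  \<open>n ^ (k - 1)\<close> sets \<open>S\<close>. As \<open>n \<le> k * (n - j)\<close>, a
  proportion of at least \<open>1 / k\<close> of the vertices is left, whence \<open>D / k\<close>
  in the exponent.\<close>

lemma card_not_rich_avoiding_le:
  fixes D \<delta> :: real
  assumes n: "card V = n" "0 < n" and j: "n \<le> k * (n - j)" "j \<le> n" and D: "0 \<le> D"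
    and deg: "\<And>S. S \<subseteq> V \<Longrightarrow> card S = k - 1 \<Longrightarrow> D \<le> card (nbh S)"
    and \<delta>: "0 \<le> \<delta>" "\<delta> \<le> 1" and c: "c = (1 - \<delta>) * D / n"
  shows "card {xs \<in> distinct_lists V j. \<not> rich_avoiding (set xs)}
    \<le> card (distinct_lists V j) * (real n ^ (k - 1) * ((real n + 1) * exp (- (D / k * \<delta>\<^sup>2 / 4))))"
proof -
  let ?x = "(real n + 1) * exp (- (D / k * \<delta>\<^sup>2 / 4))"
  let ?S = "{S. S \<subseteq> V \<and> card S = k - 1}"
  let ?B = "\<lambda>S. {Q. Q \<subseteq> V \<and> card Q = j \<and> card (nbh S - Q) < c * real (n - j)}"
  define q where "q = real (n - j) / n"
  have q: "1 / k \<le> q"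
  proof -
    have "real n \<le> real k * real (n - j)" using j(1) by (metis of_nat_le_iff of_nat_mult)
    then show ?thesis using n k2 by (simp add: q_def field_simps del: of_nat_diff)
  qed
  have q0: "0 \<le> q" by (simp add: q_def)
  have finS: "finite ?S" by (rule finite_subset[of _ "Pow V"]) (use finV in auto)
  have B: "card (?B S) \<le> (n choose j) * ?x" if S: "S \<in> ?S" for S
  proof -
    \<comment> \<open>With \<open>1 - exp (- l)\<close> replaced by \<open>l - l\<^sup>2\<close>,
      the gain is proportional to \<open>l * \<delta> - l\<^sup>2\<close>, which is largest at
      \<open>l = \<delta> / 2\<close>.\<close>
    have "card (?B S) \<le> (n choose j) * ((real n + 1) *
        exp (\<delta> / 2 * (c * real (n - j)) - real (n - j) / n * (1 - exp (- (\<delta> / 2))) * card (nbh S)))"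
      using hypergeometric_lower_tail[OF finV n j(2) nbh_subset, of "\<delta> / 2" S "c * real (n - j)"] \<delta>
      by simp
    also have "\<dots> \<le> (n choose j) * ?x"
    proof (intro mult_left_mono)
      have "(\<delta> / 2 - (\<delta> / 2)\<^sup>2) * D \<le> (1 - exp (- (\<delta> / 2))) * card (nbh S)"
        using one_minus_exp_minus_ge[of "\<delta> / 2"] \<delta> D deg S by (intro mult_mono) auto
      then have "q * ((\<delta> / 2 - (\<delta> / 2)\<^sup>2) * D) \<le> q * ((1 - exp (- (\<delta> / 2))) * card (nbh S))"
        using q0 by (rule mult_left_mono)
      moreover have "1 / k * (D * \<delta>\<^sup>2 / 4) \<le> q * (D * \<delta>\<^sup>2 / 4)"
        using q D by (intro mult_right_mono) auto
      moreover have "\<delta> / 2 * (c * real (n - j)) - q * ((\<delta> / 2 - (\<delta> / 2)\<^sup>2) * D) = - (q * (D * \<delta>\<^sup>2 / 4))"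
        unfolding c q_def using n(2) by (simp add: field_simps power2_eq_square del: of_nat_diff)
      ultimately show "exp (\<delta> / 2 * (c * real (n - j)) - real (n - j) / n * (1 - exp (- (\<delta> / 2))) * card (nbh S))
          \<le> exp (- (D / k * \<delta>\<^sup>2 / 4))"
        unfolding q_def[symmetric] exp_le_cancel_iff by (simp add: mult.assoc)
    qed auto
    finally show ?thesis .
  qed
  have "{Q. Q \<subseteq> V \<and> card Q = j \<and> \<not> rich_avoiding Q} \<subseteq> (\<Union>S\<in>?S. ?B S)"
    using n by (auto simp: rich_avoiding_def not_le)
  moreover have "finite (\<Union>S\<in>?S. ?B S)" by (rule finite_subset[of _ "Pow V"]) (use finV in auto)
  ultimately have "card {Q. Q \<subseteq> V \<and> card Q = j \<and> \<not> rich_avoiding Q} \<le> card (\<Union>S\<in>?S. ?B S)"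
    by (intro card_mono)
  also have "\<dots> \<le> (\<Sum>S\<in>?S. card (?B S))" by (rule card_UN_le[OF finS])
  finally have "real (card {Q. Q \<subseteq> V \<and> card Q = j \<and> \<not> rich_avoiding Q}) \<le> (\<Sum>S\<in>?S. real (card (?B S)))"
    unfolding of_nat_sum[symmetric] by (rule of_nat_mono)
  also have "\<dots> \<le> (\<Sum>S\<in>?S. (n choose j) * ?x)" by (rule sum_mono) (rule B)
  also have "\<dots> = real (n choose (k - 1)) * ((n choose j) * ?x)"
    using n finV by (simp add: n_subsets)
  also have "\<dots> \<le> real n ^ (k - 1) * ((n choose j) * ?x)"
    using of_nat_mono[OF binomial_le_power[of n "k - 1"], where ?'a = real]
    by (intro mult_right_mono) auto
  finally have "real (fact j) * card {Q. Q \<subseteq> V \<and> card Q = j \<and> \<not> rich_avoiding Q}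
      \<le> fact j * (real n ^ (k - 1) * ((n choose j) * ?x))"
    by simp
  then show ?thesis
    using card_distinct_lists_set[OF finV, of j "\<lambda>Q. \<not> rich_avoiding Q"] card_distinct_lists[OF finV, of j] n(1)
    by (simp add: mult_ac)
qed

text \<open>A list is bad if it is not rich or omits a vertex with fewer than \<open>h\<close> hits;
  by \<open>small\<close> the bad lists form a proportion below 1. The omitted vertices are the last
  \<open>m\<close> of the ordering.\<close>

lemma exists_balanced_ordering:
  fixes D \<delta> l h :: real
  assumes V: "card V = n" "n = k * m" "0 < m" and D: "0 \<le> D"
    and deg: "\<And>S. S \<subseteq> V \<Longrightarrow> card S = k - 1 \<Longrightarrow> D \<le> card (nbh S)"
    and \<delta>: "0 \<le> \<delta>" "\<delta> \<le> 1" and c: "c = (1 - \<delta>) * D / n" and l: "0 \<le> l"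
    and small: "(real n + 1) * (real n ^ (k - 1) * ((real n + 1) * exp (- (D / k * \<delta>\<^sup>2 / 4))))
      + n * exp (l * h - (1 - exp (- l)) * c * m) < 1"
  shows "\<exists>xs\<in>distinct_lists V ((k - 1) * m). rich xs \<and> (\<forall>v\<in>V - set xs. h \<le> hits v xs)"
proof (rule ccontr)
  assume contra: "\<not> ?thesis"
  let ?s = "(k - 1) * m"
  let ?L = "distinct_lists V ?s"
  let ?\<eta> = "real n ^ (k - 1) * ((real n + 1) * exp (- (D / k * \<delta>\<^sup>2 / 4)))"
  let ?B = "\<lambda>v. {xs \<in> ?L. rich xs \<and> v \<notin> set xs \<and> hits v xs < h}"
  have n: "0 < n" unfolding V(2) using V(3) k2 by simp
  have s: "?s + m = n" using V(2) k2 by (cases k) simp_all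
  have "card {xs \<in> ?L. \<not> rich xs} \<le> card ?L * ((real ?s + 1) * ?\<eta>)"
  proof (rule card_not_rich_le)
    fix j assume "j \<le> ?s"
    \<comment> \<open>At least \<open>m = n / k\<close> vertices remain at all times, as the
      estimate for a single prefix requires.\<close>
    then have "m \<le> n - j" "j \<le> n" using s by linarith+
    then show "card {xs \<in> distinct_lists V j. \<not> rich_avoiding (set xs)} \<le> card (distinct_lists V j) * ?\<eta>"
      using V n D deg \<delta> c by (intro card_not_rich_avoiding_le) auto
  qed
  also have "\<dots> \<le> card ?L * ((real n + 1) * ?\<eta>)"
  proof (intro mult_left_mono mult_right_mono)
    have "?s \<le> n" using s by simp
    then have "real ?s \<le> real n" by (rule of_nat_mono)
    then show "real ?s + 1 \<le> real n + 1" by simp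
  qed auto
  finally have 1: "card {xs \<in> ?L. \<not> rich xs} \<le> card ?L * ((real n + 1) * ?\<eta>)" .
  have 2: "card (?B v) \<le> card ?L * exp (l * h - (1 - exp (- l)) * c * m)" if "v \<in> V" for v
    using card_few_hits_le[OF l that, of ?s h] k2 by simp
  have "?L \<subseteq> {xs \<in> ?L. \<not> rich xs} \<union> (\<Union>v\<in>V. ?B v)"
    using contra by (auto simp: not_le)
  then have "card ?L \<le> card ({xs \<in> ?L. \<not> rich xs} \<union> (\<Union>v\<in>V. ?B v))"
    using finite_distinct_lists[OF finV] finV by (intro card_mono) auto
  also have "\<dots> \<le> card {xs \<in> ?L. \<not> rich xs} + card (\<Union>v\<in>V. ?B v)" by (rule card_Un_le)
  also have "\<dots> \<le> card {xs \<in> ?L. \<not> rich xs} + (\<Sum>v\<in>V. card (?B v))"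
    by (intro add_left_mono card_UN_le[OF finV])
  finally have "real (card ?L) \<le> card {xs \<in> ?L. \<not> rich xs} + (\<Sum>v\<in>V. real (card (?B v)))"
    unfolding of_nat_sum[symmetric] of_nat_add[symmetric] by (rule of_nat_mono)
  also have "\<dots> \<le> card ?L * ((real n + 1) * ?\<eta>) + (\<Sum>v\<in>V. card ?L * exp (l * h - (1 - exp (- l)) * c * m))"
    using 1 2 by (intro add_mono sum_mono)
  also have "\<dots> = card ?L * ((real n + 1) * ?\<eta> + n * exp (l * h - (1 - exp (- l)) * c * m))"
    using V by (simp add: distrib_left)
  also have "\<dots> < real (card ?L) * 1"
  proof (rule mult_strict_left_mono[OF small])
    have "?s \<le> n" using s by simp
    then show "0 < real (card ?L)" using card_distinct_lists[OF finV, of ?s] V(1) by simp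
  qed
  finally show False by simp
qed

section \<open>From a balanced ordering to a perfect matching\<close>

lemma block_subset: "(k - 1) * (i + 1) \<le> length xs \<Longrightarrow> block i xs \<subseteq> set xs"
  unfolding block_def by auto

lemma card_block:
  assumes "distinct xs" "(k - 1) * (i + 1) \<le> length xs"
  shows "card (block i xs) = k - 1"
proof -
  have "inj_on ((!) xs) {(k - 1) * i..<(k - 1) * (i + 1)}"
    using assms by (intro inj_on_nth) auto
  then show ?thesis unfolding block_def by (simp add: card_image)
qed

lemma block_disjoint:
  assumes "distinct xs" "(k - 1) * (i + 1) \<le> length xs" "(k - 1) * (j + 1) \<le> length xs" "i \<noteq> j"
  shows "block i xs \<inter> block j xs = {}"
proof -
  have *: "block i xs \<inter> block j xs = {}"
    if "(k - 1) * (j + 1) \<le> length xs" "i < j" for i j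
  proof -
    have le: "(k - 1) * (i + 1) \<le> (k - 1) * j" using that by (intro mult_le_mono2) simp
    have ne: "xs ! a \<noteq> xs ! b"
      if a: "a < (k - 1) * (i + 1)" and b: "(k - 1) * j \<le> b" "b < (k - 1) * (j + 1)" for a b
    proof -
      have "a < b" "b < length xs" using a b le \<open>(k - 1) * (j + 1) \<le> length xs\<close> by linarith+
      then show ?thesis using nth_eq_iff_index_eq[OF assms(1), of a b] by simp
    qed
    show ?thesis
    proof (rule equals0I)
      fix y assume "y \<in> block i xs \<inter> block j xs"
      then obtain a b where "y = xs ! a" "a < (k - 1) * (i + 1)" "y = xs ! b" "(k - 1) * j \<le> b" "b < (k - 1) * (j + 1)"
        unfolding block_def Int_iff image_iff Bex_def atLeastLessThan_iff by blast
      then show False using ne[of a b] by simp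
    qed
  qed
  show ?thesis using assms *[of j i] *[of i j] by (metis Int_commute linorder_neqE_nat)
qed

lemma Union_blocks:
  assumes "length xs = (k - 1) * m"
  shows "(\<Union>i<m. block i xs) = set xs"
proof -
  have "(\<Union>i<m. {(k - 1) * i..<(k - 1) * (i + 1)}) = {..<(k - 1) * m}"
  proof (intro equalityI subsetI)
    fix x assume "x \<in> {..<(k - 1) * m}"
    then have "x div (k - 1) < m" "x \<in> {(k - 1) * (x div (k - 1))..<(k - 1) * (x div (k - 1) + 1)}"
      using k2 dividend_less_times_div[of "k - 1" x] by (auto simp: less_mult_imp_div_less mult.commute)
    then show "x \<in> (\<Union>i<m. {(k - 1) * i..<(k - 1) * (i + 1)})" by blast
  next
    fix x assume "x \<in> (\<Union>i<m. {(k - 1) * i..<(k - 1) * (i + 1)})"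
    then obtain i where "i < m" "x < (k - 1) * (i + 1)" by auto
    moreover then have "(k - 1) * (i + 1) \<le> (k - 1) * m" by (intro mult_le_mono2) simp
    ultimately show "x \<in> {..<(k - 1) * m}" by simp
  qed
  then have "(\<Union>i<m. block i xs) = (!) xs ` {..<length xs}"
    unfolding block_def assms by (metis image_UN)
  then show ?thesis by (simp add: nth_image lessThan_atLeast0)
qed

text \<open>The blocks are matched with the \<open>m\<close> remaining vertices, and each matched
  pair is an edge. Richness gives the degrees of the blocks, \<open>hits\<close> those of the
  vertices, and sparsity of the host \<open>F\<close> passes to \<open>E\<close>.\<close>

lemma perfect_matching_of_balanced_ordering:
  assumes V: "card V = n" "n = k * m" and E: "E \<subseteq> F" and sparse: "sparse_pairs k V m h F"
    and xs: "xs \<in> distinct_lists V ((k - 1) * m)" "rich xs" and hits: "\<And>v. v \<in> V - set xs \<Longrightarrow> h \<le> hits v xs"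
    and h: "h \<le> c * m"
  shows "\<exists>M. perfect_matching \<lparr>verts = V, edges = E\<rparr> M"
proof -
  let ?W = "V - set xs"
  let ?b = "\<lambda>i. block i xs"
  let ?R = "\<lambda>i w. insert w (?b i) \<in> E"
  have len: "length xs = (k - 1) * m" and dis: "distinct xs" and sub: "set xs \<subseteq> V"
    using xs by (auto simp: distinct_lists_def)
  have cxs: "card (set xs) = (k - 1) * m" using len dis distinct_card by metis
  have le_iff: "(k - 1) * (i + 1) \<le> length xs \<longleftrightarrow> i < m" for i
    unfolding len mult_le_cancel1 using k2 by auto
  have "(k - 1) * m + m = n" using V k2 by (simp add: algebra_simps mult_eq_if)
  then have cW: "card ?W = m" "card V - card (set xs) = m"
    using cxs sub V by (auto simp: card_Diff_subset)
  have b: "?b i \<subseteq> set xs" "card (?b i) = k - 1" if "i < m" for i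
    using that le_iff block_subset card_block[OF dis] by auto
  have bdisj: "?b i \<inter> ?b j = {}" if "i < m" "j < m" "i \<noteq> j" for i j
    using that le_iff block_disjoint[OF dis] by auto
  have bne: "?b i \<noteq> {}" if "i < m" for i using b(2)[OF that] k2 by auto
  have binj: "inj_on ?b {..<m}"
    using bdisj bne by (intro inj_onI) (metis Int_absorb lessThan_iff)
  have "\<exists>f. bij_betw f {..<m} ?W \<and> (\<forall>i\<in>{..<m}. ?R i (f i))"
  proof (rule bipartite_matching_of_sparse_pairs)
    show "h \<le> card {w \<in> ?W. ?R i w}" if "i \<in> {..<m}" for i
    proof -
      have "{w \<in> ?W. ?R i w} = nbh (?b i) - set xs" using b(1)[of i] that by (auto simp: nbh_def)
      \<comment> \<open>Richness is applied to the whole list, when exactly \<open>m\<close>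
        vertices are left.\<close>
      moreover have "c * real m \<le> card (nbh (?b i) - set xs)"
        using rich_imp_rich_avoiding[OF xs(2)] b[of i] sub that cW(2) by (auto simp: rich_avoiding_def)
      ultimately show ?thesis using h by simp
    qed
    show "h \<le> card {i \<in> {..<m}. ?R i w}" if "w \<in> ?W" for w
      using hits[OF that] unfolding hits_def le_iff by simp
    fix J Y x
    assume J: "J \<subseteq> {..<m}" "card J \<le> x" and Y: "Y \<subseteq> ?W" "card Y \<le> x" and x: "1 \<le> x" "2 * x \<le> m + 1"
    have finJ: "finite J" using J finite_subset by blast
    have "finite Y" using Y finV by (meson finite_Diff finite_subset)
    \<comment> \<open>Distinct indices give distinct blocks, so related pairs map injectively to
      pairs counted in the host.\<close>
    have "card {(i, w) \<in> J \<times> Y. ?R i w} \<le> card {(f, y) \<in> ?b ` J \<times> Y. insert y f \<in> F}"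
    proof (rule card_inj_on_le)
      show "inj_on (\<lambda>(i, w). (?b i, w)) {(i, w) \<in> J \<times> Y. ?R i w}"
        using inj_on_subset[OF binj J(1)] by (auto simp: inj_on_def)
      show "finite {(f, y) \<in> ?b ` J \<times> Y. insert y f \<in> F}"
        by (rule finite_subset[of _ "?b ` J \<times> Y"]) (use finJ \<open>finite Y\<close> in auto)
    qed (use E in auto)
    moreover have "card {(f, y) \<in> ?b ` J \<times> Y. insert y f \<in> F} < h * x"
    proof -
      have "?b ` J \<subseteq> {f. f \<subseteq> V \<and> card f = k - 1}" using b J sub by fastforce
      moreover have "Y \<inter> \<Union>(?b ` J) = {}" using b(1) J Y by fastforce
      moreover have "card (?b ` J) \<le> x" using card_image_le[OF finJ, of ?b] J by simp
      moreover have "Y \<subseteq> V" using Y by auto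
      ultimately show ?thesis using sparse Y(2) x unfolding sparse_pairs_def by blast
    qed
    ultimately show "card {(i, w) \<in> J \<times> Y. ?R i w} < h * x" by linarith
  qed (use cW finV in auto)
  then obtain f where f: "bij_betw f {..<m} ?W" "\<And>i. i < m \<Longrightarrow> ?R i (f i)" by blast
  define M where "M = (\<lambda>i. insert (f i) (?b i)) ` {..<m}"
  have fW: "f i \<in> ?W" if "i < m" for i using f(1) that by (auto simp: bij_betw_def)
  have disj: "insert (f i) (?b i) \<inter> insert (f j) (?b j) = {}" if ij: "i < m" "j < m" "i \<noteq> j" for i j
  proof -
    have "f i \<noteq> f j" using f(1) ij by (auto simp: bij_betw_def inj_on_def)
    then show ?thesis using bdisj[OF ij] b(1)[OF ij(1)] b(1)[OF ij(2)] fW[OF ij(1)] fW[OF ij(2)] by auto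
  qed
  have "disjoint M"
  proof (rule disjointI)
    fix a b assume "a \<in> M" "b \<in> M" "a \<noteq> b"
    then obtain i j where ij: "i < m" "j < m" "a = insert (f i) (?b i)" "b = insert (f j) (?b j)"
      unfolding M_def image_iff Bex_def lessThan_iff by blast
    with \<open>a \<noteq> b\<close> have "i \<noteq> j" by blast
    then show "a \<inter> b = {}" unfolding ij(3,4) by (rule disj[OF ij(1,2)])
  qed
  moreover have "\<Union>M = f ` {..<m} \<union> (\<Union>i<m. ?b i)" by (auto simp: M_def)
  then have "\<Union>M = V" using f(1) Union_blocks[OF len] sub by (auto simp: bij_betw_def)
  moreover have "M \<subseteq> E" using f(2) by (auto simp: M_def)
  ultimately show ?thesis by (auto simp: perfect_matching_def)
qed

end

section \<open>The resilience theorem\<close>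

lemma exp_minus_le_inverse_power:
  assumes "0 < n" "real j * ln (real n) \<le> a"
  shows "exp (- a) \<le> 1 / real n ^ j"
proof -
  have "exp (- a) \<le> exp (- (real j * ln (real n)))" using assms by simp
  also have "\<dots> = 1 / real n ^ j" using assms by (simp add: exp_minus exp_of_nat_mult divide_inverse)
  finally show ?thesis .
qed

text \<open>An edge containing \<open>S\<close> has exactly one further vertex, so edges over
  \<open>S\<close> correspond to extensions of \<open>S\<close>.\<close>

lemma degree_eq_card_extensions:
  assumes E: "\<And>e. e \<in> edges H \<Longrightarrow> e \<subseteq> V \<and> card e = k" and S: "card S = k - 1" "finite S" and k: "0 < k"
  shows "degree H S = card {v \<in> V - S. insert v S \<in> edges H}"
  unfolding degree_def
proof (rule bij_betw_same_card[symmetric])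
  show "bij_betw (\<lambda>v. insert v S) {v \<in> V - S. insert v S \<in> edges H} {e \<in> edges H. S \<subseteq> e}"
    unfolding bij_betw_def
  proof
    show "inj_on (\<lambda>v. insert v S) {v \<in> V - S. insert v S \<in> edges H}" by (auto simp: inj_on_def)
    have "e \<in> (\<lambda>v. insert v S) ` {v \<in> V - S. insert v S \<in> edges H}" if e: "e \<in> edges H" "S \<subseteq> e" for e
    proof -
      have "card (e - S) = 1" using E[OF e(1)] e(2) S k by (simp add: card_Diff_subset)
      then obtain v where "e - S = {v}" by (auto simp: card_1_singleton_iff)
      then have "e = insert v S" "v \<in> V - S" using e(2) E[OF e(1)] by auto
      then show ?thesis using e(1) by auto
    qed
    then show "(\<lambda>v. insert v S) ` {v \<in> V - S. insert v S \<in> edges H} = {e \<in> edges H. S \<subseteq> e}" by auto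
  qed
qed

text \<open>The deterministic part: sparsity is the only random property of the host that enters.
  The lower bound on \<open>n * p\<close> makes both failure proportions in the ordering argument at
  most \<open>1 / n ^ (k + 4)\<close>.\<close>

lemma perfect_matching_of_sparse_pairs:
  fixes p \<epsilon> :: real
  assumes k: "k \<ge> 2" and \<epsilon>: "0 < \<epsilon>" "\<epsilon> \<le> 1" and n: "n = k * m" "2 \<le> n" and p: "0 \<le> p"
    and np: "512 * real k * (real k + 4) * ln n \<le> \<epsilon>\<^sup>2 * n * p"
    and H: "verts H = {1..n}" "edges H \<subseteq> F" "F \<subseteq> k_subsets k n"
    and sparse: "sparse_pairs k {1..n} m ((1 / 2 + \<epsilon> / 2) * m * p) F"
    and deg: "(1 / 2 + \<epsilon>) * n * p \<le> min_degree (k - 1) H"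
  shows "\<exists>M. perfect_matching H M"
proof -
  define D where "D = (1 / 2 + \<epsilon>) * n * p"
  \<comment> \<open>One parameter serves as the proportion lost in richness and as the tilt for the
    hits; \<open>\<epsilon> / 8\<close> fits into the gap between \<open>1 / 2 + \<epsilon>\<close>
    and \<open>1 / 2 + \<epsilon> / 2\<close>.\<close>
  define l where "l = \<epsilon> / 8"
  define c where "c = (1 - l) * D / n"
  define h where "h = (1 / 2 + \<epsilon> / 2) * m * p"
  \<comment> \<open>A common lower bound for both exponents; with 512, the richness exponent
    \<open>D / k * l\<^sup>2 / 4\<close> equals \<open>(1 + 2 * \<epsilon>) * a\<close>.\<close>
  define a where "a = \<epsilon>\<^sup>2 * n * p / (512 * k)"
  interpret codegree_ordering "{1..n}" "edges H" k c by unfold_locales (use k in auto)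
  have m: "0 < m" using n by (cases m) auto
  have kr: "real k > 0" and nr: "real n > 0" using k n(2) by auto
  have nkm: "real n = real k * real m" using n(1) by simp
  have "(real k + 4) * ln n = 512 * real k * (real k + 4) * ln n / (512 * k)" using kr by simp
  also have "\<dots> \<le> a" unfolding a_def using np kr by (intro divide_right_mono) auto
  finally have a: "real (k + 4) * ln n \<le> a" by simp
  have l: "0 < l" "l \<le> 1 / 8" using \<epsilon> by (auto simp: l_def)
  have D0: "0 \<le> D" using \<epsilon> p by (simp add: D_def)
  have amp: "a = \<epsilon>\<^sup>2 * (m * p) / 512" using kr nkm by (simp add: a_def field_simps)
  have mp: "0 \<le> real m * p" using p by simp
  have cm: "c * m = (1 - l) * (1 / 2 + \<epsilon>) * (m * p)" using nr by (simp add: c_def D_def)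
  have degS: "D \<le> card (nbh S)" if S: "S \<subseteq> {1..n}" "card S = k - 1" for S
  proof -
    let ?X = "{X. X \<subseteq> verts H \<and> card X = k - 1}"
    have "finite ?X" by (rule finite_subset[of _ "Pow {1..n}"]) (use H in auto)
    then have "min_degree (k - 1) H \<le> degree H S"
      unfolding min_degree_def using S H by (intro Min_le) auto
    also have "degree H S = card (nbh S)"
      unfolding nbh_def
      by (rule degree_eq_card_extensions) (use H S k finite_subset[OF S(1)] in \<open>auto simp: k_subsets_def\<close>)
    finally show ?thesis using deg by (simp add: D_def)
  qed
  have e1: "exp (- (D / k * l\<^sup>2 / 4)) \<le> 1 / real n ^ (k + 4)"
  proof (rule exp_minus_le_inverse_power)
    have "D / k * l\<^sup>2 / 4 = (1 + 2 * \<epsilon>) * a"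
      unfolding D_def l_def a_def using kr by (simp add: field_simps power2_eq_square)
    moreover have "0 \<le> a" unfolding amp using mp by simp
    ultimately have "a \<le> D / k * l\<^sup>2 / 4" using \<epsilon> by (simp add: mult_le_cancel_right1)
    then show "real (k + 4) * ln n \<le> D / k * l\<^sup>2 / 4" using a by linarith
  qed (use n(2) in auto)
  have e2: "exp (l * h - (1 - exp (- l)) * c * m) \<le> 1 / real n ^ (k + 4)"
  proof -
    have "(l - l\<^sup>2) * (c * m) \<le> (1 - exp (- l)) * (c * m)"
      using one_minus_exp_minus_ge[of l] l D0 by (intro mult_right_mono) (auto simp: c_def)
    moreover have "a \<le> (l - l\<^sup>2) * (c * m) - l * h"
    proof -
      \<comment> \<open>One factor \<open>1 - l\<close> comes from \<open>c\<close>, the other from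
        \<open>l - l\<^sup>2\<close>.\<close>
      have "(1 - l)\<^sup>2 \<ge> 1 - 2 * l" by (simp add: power2_eq_square algebra_simps)
      then have "(1 - 2 * l) * (1 / 2 + \<epsilon>) \<le> (1 - l)\<^sup>2 * (1 / 2 + \<epsilon>)" using \<epsilon> by (intro mult_right_mono) auto
      moreover have "(1 - 2 * l) * (1 / 2 + \<epsilon>) \<ge> 1 / 2 + 5 / 8 * \<epsilon>"
        using \<epsilon> mult_left_mono[of \<epsilon> 1 \<epsilon>] by (simp add: l_def algebra_simps)
      ultimately have "\<epsilon> / 8 \<le> (1 - l)\<^sup>2 * (1 / 2 + \<epsilon>) - (1 / 2 + \<epsilon> / 2)" by linarith
      then have "l * (m * p) * (\<epsilon> / 8) \<le> l * (m * p) * ((1 - l)\<^sup>2 * (1 / 2 + \<epsilon>) - (1 / 2 + \<epsilon> / 2))"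
        using l mp by (intro mult_left_mono) auto
      also have "\<dots> = (l - l\<^sup>2) * (c * m) - l * h"
        unfolding cm h_def by (simp add: power2_eq_square field_simps)
      finally have "\<epsilon>\<^sup>2 * (m * p) / 64 \<le> (l - l\<^sup>2) * (c * m) - l * h"
        by (simp add: l_def power2_eq_square algebra_simps)
      moreover have "a \<le> \<epsilon>\<^sup>2 * (m * p) / 64"
        unfolding amp using mp by (intro divide_left_mono) auto
      ultimately show ?thesis by linarith
    qed
    ultimately have "exp (l * h - (1 - exp (- l)) * c * m) \<le> exp (- a)"
      by (simp add: mult.assoc)
    also have "\<dots> \<le> 1 / real n ^ (k + 4)" using a n(2) by (intro exp_minus_le_inverse_power) auto
    finally show ?thesis .
  qed
  have "(real n + 1) * (real n ^ (k - 1) * ((real n + 1) * exp (- (D / k * l\<^sup>2 / 4))))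
      + n * exp (l * h - (1 - exp (- l)) * c * m) < 1"
  proof -
    \<comment> \<open>The prefactors are at most \<open>4 * n ^ (k + 1)\<close>, so the power
      \<open>k + 4\<close> leaves \<open>4 / n ^ 3\<close>. With the second term this gives
      \<open>5 / n ^ 3\<close>, below 1 already for \<open>n = 2\<close>.\<close>
    have "(real n + 1) * (real n ^ (k - 1) * ((real n + 1) * exp (- (D / k * l\<^sup>2 / 4))))
        \<le> (2 * n) * (real n ^ (k - 1) * ((2 * n) * (1 / real n ^ (k + 4))))"
      using e1 n(2) by (intro mult_mono) auto
    also have "\<dots> = 4 / real n ^ 3"
    proof -
      have "real n ^ (k + 4) = real n ^ (k - 1) * n * n * real n ^ 3"
        using k by (cases k) (simp_all add: eval_nat_numeral mult_ac)
      then show ?thesis using nr by simp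
    qed
    finally have 1: "(real n + 1) * (real n ^ (k - 1) * ((real n + 1) * exp (- (D / k * l\<^sup>2 / 4)))) \<le> 4 / real n ^ 3" .
    have "n * exp (l * h - (1 - exp (- l)) * c * m) \<le> n * (1 / real n ^ (k + 4))"
      using e2 by (intro mult_left_mono) auto
    also have "\<dots> = 1 / real n ^ (k + 3)" using nr by (simp add: numeral_eq_Suc)
    also have "\<dots> \<le> 1 / real n ^ 3"
      using n(2) by (intro divide_left_mono power_increasing mult_pos_pos) auto
    finally have 2: "n * exp (l * h - (1 - exp (- l)) * c * m) \<le> 1 / real n ^ 3" .
    have "(2::real) ^ 3 \<le> real n ^ 3" using n(2) by (intro power_mono) auto
    then have "5 / real n ^ 3 < 1" by (simp add: divide_less_eq)
    then show ?thesis using 1 2 by (simp add: add_divide_distrib[symmetric])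
  qed
  then obtain xs where xs: "xs \<in> distinct_lists {1..n} ((k - 1) * m)" "rich xs"
      "\<And>v. v \<in> {1..n} - set xs \<Longrightarrow> h \<le> hits v xs"
    using exists_balanced_ordering[of n m D l l h] n m D0 degS l c_def by auto
  have "h \<le> c * m"
  proof -
    have "\<epsilon> * \<epsilon> \<le> \<epsilon>" using \<epsilon> by (simp add: mult_left_le)
    moreover have "(1 - l) * (1 / 2 + \<epsilon>) = 1 / 2 + 15 / 16 * \<epsilon> - \<epsilon> * \<epsilon> / 8"
      by (simp add: l_def field_simps)
    ultimately have "1 / 2 + \<epsilon> / 2 \<le> (1 - l) * (1 / 2 + \<epsilon>)" using \<epsilon>(1) by linarith
    from mult_right_mono[OF this mp] show ?thesis by (simp only: cm h_def mult.assoc)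
  qed
  then have "\<exists>M. perfect_matching \<lparr>verts = {1..n}, edges = edges H\<rparr> M"
    using xs n H(2) sparse by (intro perfect_matching_of_balanced_ordering[of n m F h xs]) (auto simp: h_def)
  then show ?thesis using H(1) by (simp add: perfect_matching_def)
qed

text \<open>A pair of size \<open>x\<close> spans at most \<open>x * x * p\<close> edges on average,
  roughly at most \<open>x * m * p / 2\<close>, and \<open>h * x\<close> exceeds the latter by the
  factor \<open>1 + \<epsilon>\<close>. Tilting by \<open>\<epsilon> / 4\<close> yields a factor
  \<open>exp b\<close> per unit of \<open>x\<close>, which beats the \<open>n ^ k\<close>
  choices.\<close>

lemma prob_not_sparse_pairs_le_inverse:
  fixes p \<epsilon> :: real
  assumes k: "k \<ge> 2" and \<epsilon>: "0 < \<epsilon>" "\<epsilon> \<le> 1" and n: "n = k * m" "2 \<le> n" and m: "4 \<le> \<epsilon> * m"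
    and p: "0 \<le> p" "p \<le> 1" and np: "512 * real k * (real k + 4) * ln n \<le> \<epsilon>\<^sup>2 * n * p"
  shows "measure_pmf.prob (random_hypergraph k n p)
      {G. \<not> sparse_pairs k {1..n} m ((1 / 2 + \<epsilon> / 2) * m * p) (edges G)} \<le> 1 / n"
proof -
  define l where "l = \<epsilon> / 4"
  define h where "h = (1 / 2 + \<epsilon> / 2) * m * p"
  define b where "b = - (\<epsilon>\<^sup>2 * (m * p) / 32)"
  have kr: "real k > 0" and nr: "real n > 0" using k n(2) by auto
  have nkm: "real n = real k * real m" using n(1) by simp
  have lnn: "0 < ln (real n)" using n(2) by simp
  have "0 < 512 * real k * (real k + 4) * ln n" using kr lnn by (intro mult_pos_pos) auto
  then have "0 < \<epsilon>\<^sup>2 * n * p" using np by linarith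
  then have p0: "0 < p" using p by (cases "p = 0") auto
  have m0: "0 < real m" using nkm nr by (cases m) auto
  have h0: "0 < h" using p0 m0 \<epsilon> by (simp add: h_def)
  have eb: "exp b \<le> 1 / real n ^ (k + 4)"
    unfolding b_def
  proof (rule exp_minus_le_inverse_power)
    have "(real k + 4) * ln n = 512 * real k * (real k + 4) * ln n / (512 * k)" using kr by simp
    also have "\<dots> \<le> \<epsilon>\<^sup>2 * n * p / (512 * k)" using np kr by (intro divide_right_mono) auto
    also have "\<dots> = \<epsilon>\<^sup>2 * (m * p) / 512" using kr nkm by (simp add: field_simps)
    also have "\<dots> \<le> \<epsilon>\<^sup>2 * (m * p) / 32" using p by (intro divide_left_mono) auto
    finally show "real (k + 4) * ln n \<le> \<epsilon>\<^sup>2 * (m * p) / 32" by simp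
  qed (use n(2) in auto)
  have "real n ^ k * exp b \<le> real n ^ k * (1 / real n ^ (k + 4))" using eb by (intro mult_left_mono) auto
  also have "\<dots> = 1 / real n ^ 4" using nr by (simp add: power_add)
  finally have nb: "real n ^ k * exp b \<le> 1 / real n ^ 4" .
  have n4: "1 / real n ^ 4 \<le> 1" using n(2) by simp
  have "measure_pmf.prob (random_hypergraph k n p) {G. \<not> sparse_pairs k {1..n} m h (edges G)}
      \<le> real n * (real n ^ k * exp b)"
  proof (rule prob_not_sparse_pairs_le)
    show "real x * p * (exp l - 1) - l * h \<le> b" if x: "1 \<le> x" "2 * x \<le> m + 1" for x
    proof -
      have "exp l \<le> 1 + l + l\<^sup>2" using \<epsilon> by (intro exp_bound) (auto simp: l_def)
      then have "real x * p * (exp l - 1) \<le> real x * p * (l + l\<^sup>2)" using p by (intro mult_left_mono) auto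
      also have "\<dots> \<le> ((1 + l) * m / 2) * p * (l + l\<^sup>2)"
      proof (intro mult_right_mono)
        \<comment> \<open>The assumption \<open>4 \<le> \<epsilon> * m\<close> absorbs the
          \<open>+ 1\<close> into the factor \<open>1 + l\<close>.\<close>
        have "2 * real x \<le> real m + 1" using x(2) by linarith
        then show "real x \<le> (1 + l) * m / 2" using m by (simp add: l_def field_simps)
      qed (use p \<epsilon> in \<open>auto simp: l_def\<close>)
      \<comment> \<open>The square collects \<open>1 + l\<close> from the range of \<open>x\<close>
        and \<open>1 + l\<close> from \<open>l + l\<^sup>2\<close>.\<close>
      also have "\<dots> - l * h = l * (m * p) / 2 * ((1 + l)\<^sup>2 - (1 + \<epsilon>))"
        by (simp add: h_def power2_eq_square field_simps)
      also have "\<dots> \<le> l * (m * p) / 2 * (- (\<epsilon> / 4))"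
      proof (rule mult_left_mono)
        show "(1 + l)\<^sup>2 - (1 + \<epsilon>) \<le> - (\<epsilon> / 4)"
          using \<epsilon> mult_left_mono[of \<epsilon> 1 \<epsilon>] by (simp add: l_def power2_eq_square algebra_simps)
      qed (use \<epsilon> p in \<open>auto simp: l_def\<close>)
      also have "\<dots> = b" by (simp add: b_def l_def power2_eq_square)
      finally show ?thesis by simp
    qed
    show "m \<le> n" using n k by simp
  qed (use k p \<epsilon> h0 nb n4 in \<open>auto simp: l_def\<close>)
  also have "\<dots> \<le> real n * (1 / real n ^ 4)" using nb by (intro mult_left_mono) auto
  also have "\<dots> = 1 / real n ^ 3" using nr by (simp add: numeral_eq_Suc)
  also have "\<dots> \<le> 1 / real n ^ 1" using n(2) by (intro divide_left_mono power_increasing mult_pos_pos) auto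
  finally show ?thesis by (simp add: h_def)
qed

text \<open>The filter lets \<open>n\<close> tend to infinity through the multiples of
  \<open>k\<close>. For all large such \<open>n\<close> the failure probability is at most
  \<open>1 / n\<close>.\<close>

theorem theorem1p1:
  fixes k :: nat and \<epsilon> :: real
  assumes "k \<ge> 2" and "\<epsilon> > 0"
  shows "\<exists>C\<^sub>0 :: real. \<forall>C \<ge> C\<^sub>0. \<forall>p :: nat \<Rightarrow> real.
    (\<forall>\<^sub>F n in inf sequentially (principal {n. k dvd n}). C * ln (real n) / real n \<le> p n \<and> p n \<le> 1) \<longrightarrow>
    ((\<lambda>n. measure_pmf.prob (random_hypergraph k n (p n))
        {G. \<forall>H. spanning_subhypergraph H G \<and>
               real (min_degree (k - 1) H) \<ge> (1 / 2 + \<epsilon>) * real n * p n \<longrightarrow>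
             (\<exists>M. perfect_matching H M)})
      \<longlongrightarrow> 1) (inf sequentially (principal {n. k dvd n}))"
proof -
  \<comment> \<open>Lowering \<open>\<epsilon>\<close> to at most 1 only weakens the degree
    condition, so a matching result for \<open>e\<close> suffices.\<close>
  define e where "e = min \<epsilon> 1"
  have e: "0 < e" "e \<le> 1" "e \<le> \<epsilon>" using assms by (auto simp: e_def)
  \<comment> \<open>Chosen so that \<open>e\<^sup>2 * C0\<close> is the constant in the lower bound
    for \<open>n * p\<close> used above.\<close>
  define C0 where "C0 = 512 * real k * (real k + 4) / e\<^sup>2"
  let ?F = "inf sequentially (principal {n. k dvd n})"
  show ?thesis
  proof (rule exI[of _ C0], intro allI impI)
    fix C p assume C: "C0 \<le> C"
      and ev: "\<forall>\<^sub>F n in ?F. C * ln (real n) / real n \<le> p n \<and> p n \<le> 1"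
    let ?A = "\<lambda>n. {G. \<forall>H. spanning_subhypergraph H G \<and>
        (1 / 2 + \<epsilon>) * real n * p n \<le> real (min_degree (k - 1) H) \<longrightarrow> (\<exists>M. perfect_matching H M)}"
    let ?P = "\<lambda>n. measure_pmf.prob (random_hypergraph k n (p n)) (?A n)"
    have bound: "1 - 1 / n \<le> ?P n"
      if n: "2 \<le> n" "4 * k / e \<le> n" "k dvd n" and pn: "C * ln (real n) / real n \<le> p n" "p n \<le> 1" for n
    proof -
      obtain m where m: "n = k * m" using n(3) by blast
      have nr: "0 < real n" and kr: "0 < real k" using n assms by auto
      have lnn: "0 \<le> ln (real n)" using n by simp
      have "0 \<le> C0" by (simp add: C0_def)
      then have "0 \<le> C * ln (real n) / real n" using C lnn by simp
      then have p0: "0 \<le> p n" using pn by linarith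
      have "C0 * ln (real n) \<le> C * ln (real n)" using C lnn by (intro mult_right_mono)
      also have "\<dots> \<le> n * p n" using pn nr by (simp add: field_simps)
      finally have "e\<^sup>2 * (C0 * ln (real n)) \<le> e\<^sup>2 * (n * p n)" by (intro mult_left_mono) auto
      then have np: "512 * real k * (real k + 4) * ln n \<le> e\<^sup>2 * n * p n" using e by (simp add: C0_def mult.assoc)
      have me: "4 \<le> e * m" using n(2) e kr unfolding m by (simp add: field_simps)
      let ?h = "(1 / 2 + e / 2) * m * p n"
      let ?B = "{G. \<not> sparse_pairs k {1..n} m ?h (edges G)}"
      let ?R = "random_hypergraph k n (p n)"
      have "measure_pmf.prob ?R ?B \<le> 1 / n"
        using assms(1) e m n(1) me p0 pn(2) np by (intro prob_not_sparse_pairs_le_inverse) auto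
      moreover have "measure_pmf.prob ?R (- ?A n) \<le> measure_pmf.prob ?R ?B"
      proof (rule measure_pmf.finite_measure_mono_AE)
        \<comment> \<open>The inclusion is needed only on the support, where the host is
          \<open>k\<close>-uniform with vertex set \<open>{1..n}\<close>.\<close>
        show "AE G in ?R. G \<in> - ?A n \<longrightarrow> G \<in> ?B"
        proof (rule AE_pmfI, intro impI)
          fix G assume "G \<in> set_pmf ?R" and "G \<in> - ?A n"
          then have G: "verts G = {1..n}" "edges G \<subseteq> k_subsets k n" by (auto simp: random_hypergraph_def)
          from \<open>G \<in> - ?A n\<close> obtain H where H: "verts H = verts G" "edges H \<subseteq> edges G"
            "(1 / 2 + \<epsilon>) * n * p n \<le> min_degree (k - 1) H" and noM: "\<not> (\<exists>M. perfect_matching H M)"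
            by (auto simp: spanning_subhypergraph_def)
          have "(1 / 2 + e) * n * p n \<le> (1 / 2 + \<epsilon>) * n * p n"
            using e p0 by (intro mult_right_mono) auto
          then have "(1 / 2 + e) * n * p n \<le> min_degree (k - 1) H" using H(3) by linarith
          then have "\<not> sparse_pairs k {1..n} m ?h (edges G)"
            using noM perfect_matching_of_sparse_pairs[OF assms(1) e(1,2) m n(1) p0 np, of H "edges G"] H G
            by auto
          then show "G \<in> ?B" by simp
        qed
      qed auto
      moreover have "measure_pmf.prob ?R (- ?A n) = 1 - ?P n"
        using measure_pmf.prob_compl[of "?A n" ?R] by (simp add: Compl_eq_Diff_UNIV)
      ultimately show ?thesis by linarith
    qed
    have "\<forall>\<^sub>F n in sequentially. 2 \<le> n \<and> 4 * k / e \<le> real n"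
      by (intro eventually_conj eventually_ge_at_top filterlim_real_sequentially[THEN filterlim_at_top[THEN iffD1], rule_format])
    then have "\<forall>\<^sub>F n in ?F. 2 \<le> n \<and> 4 * k / e \<le> real n" by (rule filter_leD[OF inf_le1])
    moreover have "\<forall>\<^sub>F n in ?F. k dvd n" by (auto simp: eventually_inf_principal)
    ultimately have lower: "\<forall>\<^sub>F n in ?F. 1 - 1 / real n \<le> ?P n"
      using ev by eventually_elim (use bound in auto)
    have "((\<lambda>n. 1 - 1 / real n) \<longlongrightarrow> 1 - 0) ?F"
      by (intro tendsto_mono[OF inf_le1] tendsto_diff tendsto_const lim_1_over_n)
    then have lim: "((\<lambda>n. 1 - 1 / real n) \<longlongrightarrow> 1) ?F" by simp
    show "(?P \<longlongrightarrow> 1) ?F"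
      by (rule tendsto_sandwich[OF lower _ lim tendsto_const]) (auto intro: always_eventually)
  qed
qed

end
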